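(* Let $d\in\mathbb{N}$, $\Omega=[-1,1]^d$, $\alpha>0$, and $$\mathcal S=\{\,x\mapsto\bar g(x)+\alpha\|x\| \;:\; \bar g\in C^1(\Omega;\mathbb{R}_+),\ \bar g(0)=0\,\}.$$ Let $\delta>0$, $\Omega_\delta=\Omega\setminus B(0;\delta)$, and let $\bar\alpha\in(0,\alpha)$. Then the set of Lyapunov-Nets $$V_\theta(x)=|\phi_\theta(x)-\phi_\theta(0)|+\bar\alpha\|x\|,$$ where $\phi_\theta:\mathbb{R}^d\to\mathbb{R}$ ranges over RePU networks (of arbitrary depth and widths) with bounded weights $\theta\in[-1,1]^m$, $m$ being the number of trainable parameters of $\phi_\theta$, is dense in $\mathcal S$ under the $W^{1,\infty}(\Omega_\delta)$ norm. That is, for every $h\in\mathcal S$ and every $\epsilon>0$ there exist a RePU network architecture with some number $m$ of trainable parameters and a parameter vector $\theta\in[-1,1]^m$ such that $\|V_\theta-h\|_{W^{1,\infty}(\Omega_\delta)}\le\epsilon$.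
   Context: Notation: $\|\cdot\|$ is the Euclidean norm, $B(0;\delta)=\{y\in\mathbb{R}^d:\|y\|<\delta\}$, $\mathbb{R}_+=[0,\infty)$, and $C^1(\Omega;\mathbb{R}_+)$ is the set of continuously differentiable functions on $\Omega$ with values in $\mathbb{R}_+$. RePU network: $\mathrm{RePU}(t)=\max\{0,t\}^2$, applied componentwise. A RePU network $\phi_\theta:\mathbb{R}^d\to\mathbb{R}$ is a feed-forward neural network of the form $z_0=x$, $z_\ell=\mathrm{RePU}(A_\ell z_{\ell-1}+b_\ell)$ for the hidden layers $\ell=1,\dots,L$, followed by an affine scalar output $\phi_\theta(x)=A_{L+1}z_L+b_{L+1}$. The vector $\theta\in\mathbb{R}^m$ collects all entries of the weight matrices $A_\ell$ and biases $b_\ell$. The $W^{1,\infty}$ norm is $$\|g\|_{W^{1,\infty}(\Omega_\delta)}=\max\Big\{\operatorname*{ess\,sup}_{x\in\Omega_\delta}|g(x)|,\ \max_{1\le i\le d}\operatorname*{ess\,sup}_{x\in\Omega_\delta}|D_ig(x)|\Big\},$$ where $D_ig$ is the weak partial derivative of $g$ with respect to $x_i$. *)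

theory Defs
  imports
    "HOL-Probability.Essential_Supremum"
    "Jordan_Normal_Form.Matrix"
begin

section \<open>Weak derivatives and the norm of $W^{1,\infty}$\<close>

definition partial_derivative :: "'n::finite \<Rightarrow> (real^'n \<Rightarrow> real) \<Rightarrow> real^'n \<Rightarrow> real" where
  "partial_derivative i f x = frechet_derivative f (at x) (axis i 1)"

primrec Ck :: "nat \<Rightarrow> (real^'n::finite \<Rightarrow> real) \<Rightarrow> bool" where
  "Ck 0 f \<longleftrightarrow> continuous_on UNIV f"
| "Ck (Suc k) f \<longleftrightarrow> (\<forall>x. f differentiable (at x)) \<and> (\<forall>i. Ck k (partial_derivative i f))"

definition test_functions :: "(real^'n::finite) set \<Rightarrow> (real^'n \<Rightarrow> real) set" where
  "test_functions U =
    {\<psi>. (\<forall>k. Ck k \<psi>) \<and> compact (closure {x. \<psi> x \<noteq> 0}) \<and> closure {x. \<psi> x \<noteq> 0} \<subseteq> U}"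

definition locally_integrable :: "(real^'n::finite) set \<Rightarrow> (real^'n \<Rightarrow> real) \<Rightarrow> bool" where
  "locally_integrable U f \<longleftrightarrow> (\<forall>K. compact K \<and> K \<subseteq> U \<longrightarrow> set_integrable lebesgue K f)"

definition has_weak_partial ::
    "(real^'n::finite) set \<Rightarrow> 'n \<Rightarrow> (real^'n \<Rightarrow> real) \<Rightarrow> (real^'n \<Rightarrow> real) \<Rightarrow> bool" where
  "has_weak_partial U i g v \<longleftrightarrow>
    locally_integrable U g \<and> locally_integrable U v \<and>
    (\<forall>\<psi> \<in> test_functions U.
      (LINT x|lebesgue_on U. g x * partial_derivative i \<psi> x) = - (LINT x|lebesgue_on U. v x * \<psi> x))"

definition sup_norm :: "(real^'n::finite) set \<Rightarrow> (real^'n \<Rightarrow> real) \<Rightarrow> ennreal" where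
  "sup_norm S f = esssup (lebesgue_on S) (\<lambda>x. ennreal \<bar>f x\<bar>)"

text \<open>Weak derivatives are taken on the interior of \<open>S\<close>, and \<open>S\<close> is assumed to have a null boundary.
  A weak derivative is determined up to a null set, so \<open>sup_norm S v\<close> is the same for all weak
  partials \<open>v\<close> of \<open>g\<close>, and the infimum below is this common value; it is \<open>\<infinity>\<close> if there is no weak
  partial.\<close>

definition W1inf_norm :: "(real^'n::finite) set \<Rightarrow> (real^'n \<Rightarrow> real) \<Rightarrow> ennreal" where
  "W1inf_norm S g =
    max (sup_norm S g) (MAX i. INF v \<in> {v. has_weak_partial (interior S) i g v}. sup_norm S v)"


section \<open>RePU networks\<close>

definition RePU :: "real \<Rightarrow> real" where
  "RePU t = (max 0 t)\<^sup>2"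

text \<open>A layer is a pair of a weight matrix and a bias vector. A network is the list of its hidden
  layers together with the affine output layer.\<close>

type_synonym layer = "real Matrix.mat \<times> real Matrix.vec"

type_synonym network = "layer list \<times> layer"

definition affine_layer :: "layer \<Rightarrow> real Matrix.vec \<Rightarrow> real Matrix.vec" where
  "affine_layer l z = fst l *\<^sub>v z + snd l"

definition layer_dims :: "nat \<Rightarrow> nat \<Rightarrow> layer \<Rightarrow> bool" where
  "layer_dims n k l \<longleftrightarrow> fst l \<in> carrier_mat k n \<and> snd l \<in> carrier_vec k"

primrec hidden_dims :: "nat \<Rightarrow> nat \<Rightarrow> layer list \<Rightarrow> bool" where
  "hidden_dims n k [] \<longleftrightarrow> n = k"
| "hidden_dims n k (l # ls) \<longleftrightarrow> (\<exists>w>0. layer_dims n w l \<and> hidden_dims w k ls)"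

primrec hidden_output :: "layer list \<Rightarrow> real Matrix.vec \<Rightarrow> real Matrix.vec" where
  "hidden_output [] z = z"
| "hidden_output (l # ls) z = hidden_output ls (map_vec RePU (affine_layer l z))"

text \<open>\<open>from_nat_into UNIV\<close> enumerates the finite index type. The choice of the enumeration only
  permutes the columns of the first weight matrix.\<close>

definition coords :: "real^'n::finite \<Rightarrow> real Matrix.vec" where
  "coords x = Matrix.vec CARD('n) (\<lambda>k. vec_nth x (from_nat_into UNIV k))"

definition is_network :: "nat \<Rightarrow> network \<Rightarrow> bool" where
  "is_network d N \<longleftrightarrow> fst N \<noteq> [] \<and> (\<exists>k. hidden_dims d k (fst N) \<and> layer_dims k 1 (snd N))"

definition realize :: "network \<Rightarrow> real^'n::finite \<Rightarrow> real" where
  "realize N x = vec_index (affine_layer (snd N) (hidden_output (fst N) (coords x))) 0"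

definition layer_params :: "layer \<Rightarrow> real list" where
  "layer_params l =
    [fst l $$ (i, j). i \<leftarrow> [0..<dim_row (fst l)], j \<leftarrow> [0..<dim_col (fst l)]] @ list_of_vec (snd l)"

definition params :: "network \<Rightarrow> real list" where
  "params N = concat (map layer_params (fst N @ [snd N]))"

definition lyapunov_net :: "real \<Rightarrow> network \<Rightarrow> real^'n::finite \<Rightarrow> real" where
  "lyapunov_net a N x = \<bar>realize N x - realize N (0::real^'n)\<bar> + a * norm x"


section \<open>The class of target functions\<close>

definition cube :: "(real^'n::finite) set" where
  "cube = cbox (- 1) 1"

definition C1_on :: "(real^'n::finite) set \<Rightarrow> (real^'n \<Rightarrow> real) \<Rightarrow> bool" where
  "C1_on S f \<longleftrightarrow>
    (\<exists>f'. continuous_on S f' \<and> (\<forall>x\<in>S. (f has_derivative inner (f' x)) (at x within S)))"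

definition target_class :: "real \<Rightarrow> (real^'n::finite \<Rightarrow> real) set" where
  "target_class \<alpha> =
    {(\<lambda>x. g x + \<alpha> * norm x) | g. C1_on cube g \<and> (\<forall>x\<in>cube. 0 \<le> g x) \<and> g 0 = 0}"

end

theory Submission
  imports Defs
begin

text \<open>On \<open>\<Omega>\<^sub>\<delta>\<close> the absolute value is harmless: with \<open>\<beta> = \<alpha> - \<alpha>'\<close>, the function
  \<open>g x + \<beta> * norm x\<close> is at least \<open>\<beta> * \<delta>\<close> there, so a network that is close to it on \<open>\<Omega>\<^sub>\<delta>\<close> and
  close to \<open>0\<close> at the origin has \<open>realize N x > realize N 0\<close>. The norm is smoothed to
  \<open>sqrt (\<tau>\<^sup>2 + inner x x) - \<tau>\<close>, which makes the target \<open>C\<^sup>1\<close> on the whole cube.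

  A \<open>C\<^sup>1\<close> function on the cube is approximated in \<open>C\<^sup>1\<close> by polynomials, replacing one coordinate
  after the other by its Bernstein approximation. The derivative in that coordinate is a
  Bernstein average of difference quotients, hence by the mean value theorem of values of the partial
  derivative at nearby points.

  Polynomials are RePU networks since \<open>t\<^sup>2 = RePU t + RePU (- t)\<close> and products are differences of
  squares; large weights are avoided by repeating neurons.

  For a classical derivative to be a weak one, it suffices that a directional derivative of a
  compactly supported function has integral \<open>0\<close>, which follows from translation invariance of the
  Lebesgue measure by dominated convergence.\<close>

section \<open>Polynomial approximation in $C^1$ on the cube\<close>

text \<open>De Casteljau's algorithm: the value at \<open>t\<close> of the Bernstein polynomial of
  degree \<open>m\<close> with coefficients \<open>c\<close>, that is, the mean of \<open>c\<close>
  under the binomial distribution with parameters \<open>m\<close> and \<open>t\<close>. The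
  recursion avoids binomial coefficients. The coefficients may be vectors, so that gradients can be
  averaged too.\<close>

fun casteljau :: "nat \<Rightarrow> (nat \<Rightarrow> 'a::real_vector) \<Rightarrow> real \<Rightarrow> 'a" where
  "casteljau 0 c t = c 0"
| "casteljau (Suc m) c t = (1 - t) *\<^sub>R casteljau m c t + t *\<^sub>R casteljau m (\<lambda>k. c (Suc k)) t"

lemma casteljau_cong: "(\<And>k. k \<le> m \<Longrightarrow> c k = c' k) \<Longrightarrow> casteljau m c t = casteljau m c' t"
proof (induction m arbitrary: c c')
  case (Suc m)
  have "casteljau m c t = casteljau m c' t" "casteljau m (\<lambda>k. c (Suc k)) t = casteljau m (\<lambda>k. c' (Suc k)) t"
    by (rule Suc.IH; simp add: Suc.prems)+
  then show ?case by simp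
qed simp

lemma casteljau_const [simp]: "casteljau m (\<lambda>k. a) t = a"
  by (induction m) (auto simp: algebra_simps)

lemma casteljau_linear:
  assumes "linear h"
  shows "casteljau m (\<lambda>k. h (c k)) t = h (casteljau m c t)"
  by (induction m arbitrary: c) (auto simp: linear_add[OF assms] linear_scale[OF assms])

lemma casteljau_add: "casteljau m (\<lambda>k. c k + c' k) t = casteljau m c t + casteljau m c' t"
  by (induction m arbitrary: c c') (auto simp: algebra_simps)

lemma casteljau_diff: "casteljau m (\<lambda>k. c k - c' k) t = casteljau m c t - casteljau m c' t"
  by (induction m arbitrary: c c') (simp_all add: scaleR_diff_right)

lemma casteljau_scaleR: "casteljau m (\<lambda>k. a *\<^sub>R c k) t = a *\<^sub>R casteljau m c t"
  by (induction m arbitrary: c) (auto simp: algebra_simps)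

text \<open>For \<open>t\<close> in the unit interval each recursion step is a convex combination.
  The bound may depend on \<open>k\<close>, so that a bound quadratic in \<open>k\<close> can be
  averaged.\<close>

lemma norm_casteljau_le:
  fixes c :: "nat \<Rightarrow> 'a::real_normed_vector"
  assumes "0 \<le> t" "t \<le> 1" "\<And>k. k \<le> m \<Longrightarrow> norm (c k) \<le> b k"
  shows "norm (casteljau m c t) \<le> casteljau m b t"
  using assms(3)
proof (induction m arbitrary: c b)
  case (Suc m)
  have 1: "norm (casteljau m c t) \<le> casteljau m b t"
    by (rule Suc.IH) (simp add: Suc.prems)
  have 2: "norm (casteljau m (\<lambda>k. c (Suc k)) t) \<le> casteljau m (\<lambda>k. b (Suc k)) t"
    by (rule Suc.IH) (simp add: Suc.prems)
  have "norm (casteljau (Suc m) c t) \<le>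
    (1 - t) * norm (casteljau m c t) + t * norm (casteljau m (\<lambda>k. c (Suc k)) t)"
    using assms(1,2) by (auto intro!: order_trans[OF norm_triangle_ineq])
  also have "\<dots> \<le> (1 - t) * casteljau m b t + t * casteljau m (\<lambda>k. b (Suc k)) t"
    using 1 2 assms(1,2) by (intro add_mono mult_left_mono) auto
  finally show ?case by simp
qed simp

text \<open>The second moment of the binomial distribution about \<open>- a\<close>. The shift makes
  the induction work: passing to the coefficients at \<open>Suc k\<close> replaces \<open>a\<close>
  by \<open>a + 1\<close>.\<close>

lemma casteljau_square_moment:
  "casteljau m (\<lambda>k. (a + real k)\<^sup>2) t = (a + m * t)\<^sup>2 + m * t * (1 - t)"
proof (induction m arbitrary: a)
  case (Suc m)
  have "casteljau m (\<lambda>k. (a + real (Suc k))\<^sup>2) t = casteljau m (\<lambda>k. ((a + 1) + real k)\<^sup>2) t"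
    by (simp add: algebra_simps)
  also have "\<dots> = (a + 1 + m * t)\<^sup>2 + m * t * (1 - t)"
    by (rule Suc.IH)
  finally show ?case
    by (simp only: casteljau.simps Suc.IH real_scaleR_def) (simp add: algebra_simps power2_eq_square)
qed simp

lemma casteljau_variance:
  "casteljau m (\<lambda>k. (real k - real m * t)\<^sup>2) t = m * t * (1 - t)"
  using casteljau_square_moment[of m "- (real m * t)" t] by simp


section \<open>Bernstein approximation in one coordinate of the cube\<close>

definition upd :: "real^'n::finite \<Rightarrow> 'n \<Rightarrow> real \<Rightarrow> real^'n" where
  "upd z i s = z + (s - vec_nth z i) *\<^sub>R axis i 1"

lemma cube_iff: "x \<in> cube \<longleftrightarrow> (\<forall>i. -1 \<le> vec_nth x i \<and> vec_nth x i \<le> 1)"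
  by (simp add: cube_def mem_box_cart)

lemma cubeD: "x \<in> cube \<Longrightarrow> \<bar>vec_nth x i\<bar> \<le> 1"
  by (simp add: cube_iff abs_le_iff)

lemma compact_cube: "compact cube"
  by (simp add: cube_def)

lemma vec_nth_upd: "vec_nth (upd z i s) j = (if j = i then s else vec_nth z j)"
  by (simp add: upd_def axis_def)

lemma upd_in_cube: "z \<in> cube \<Longrightarrow> s \<in> {-1..1} \<Longrightarrow> upd z i s \<in> cube"
  by (simp add: cube_iff vec_nth_upd)

lemma dist_upd: "dist (upd z i s) z = \<bar>s - vec_nth z i\<bar>"
  by (simp add: upd_def dist_norm norm_axis_1)

lemma square_sum_le: "(a + b)\<^sup>2 \<le> 2 * a\<^sup>2 + 2 * b\<^sup>2" for a b :: real
  using zero_le_power2[of "a - b"] by (simp add: power2_eq_square algebra_simps)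

text \<open>Bernstein's proof of the Weierstrass theorem: nodes close to \<open>z\<close> are
  handled by uniform continuity, the others by the binomial variance. The nodes may deviate by
  \<open>2 / m\<close> from the equidistant ones; this slack admits the intermediate points that the
  mean value theorem supplies for the derivative. The threshold is uniform in \<open>z\<close> and
  in the nodes.\<close>

lemma casteljau_tendsto:
  fixes u :: "real^'n::finite \<Rightarrow> 'b::real_normed_vector"
  assumes u: "continuous_on cube u" and e: "0 < e"
  obtains M where "\<And>m \<xi> z. M \<le> m \<Longrightarrow> z \<in> cube \<Longrightarrow>
      (\<And>k. k \<le> m \<Longrightarrow> \<xi> k \<in> {-1..1} \<and> \<bar>\<xi> k - (2 * real k / real m - 1)\<bar> \<le> 2 / real m) \<Longrightarrow>
      norm (casteljau m (\<lambda>k. u (upd z i (\<xi> k))) ((1 + vec_nth z i) / 2) - u z) \<le> e"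
proof -
  have "uniformly_continuous_on cube u"
    by (rule compact_uniformly_continuous[OF u compact_cube])
  then obtain d where d: "0 < d"
    "\<And>x y. x \<in> cube \<Longrightarrow> y \<in> cube \<Longrightarrow> dist y x < d \<Longrightarrow> dist (u y) (u x) < e / 2"
    using e unfolding uniformly_continuous_on_def by (meson half_gt_zero)
  have "bounded (u ` cube)"
    by (rule compact_imp_bounded[OF compact_continuous_image[OF u compact_cube]])
  then obtain B where B: "0 < B" "\<And>x. x \<in> cube \<Longrightarrow> norm (u x) \<le> B"
    unfolding bounded_pos by blast
  \<comment> \<open>With this \<open>K\<close>, the quantity \<open>K * r\<^sup>2\<close> exceeds
    the largest possible oscillation \<open>2 * B\<close> as soon as \<open>r\<close> reaches
    \<open>d\<close>.\<close>
  define K where "K = 2 * B / d\<^sup>2"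
  have K: "0 < K"
    using B d by (simp add: K_def)
  \<comment> \<open>The final error is \<open>e / 2 + 16 * K / m\<close>, which is at most
    \<open>e\<close> once \<open>m\<close> exceeds \<open>32 * K / e\<close>.\<close>
  obtain M0 :: nat where M0: "32 * K / e < real M0"
    using reals_Archimedean2 by blast
  show thesis
  proof (rule that[of "Suc M0"])
    fix m \<xi> and z :: "real^'n"
    assume m: "Suc M0 \<le> m" and z: "z \<in> cube"
      and \<xi>: "\<And>k. k \<le> m \<Longrightarrow> \<xi> k \<in> {-1..1} \<and> \<bar>\<xi> k - (2 * real k / real m - 1)\<bar> \<le> 2 / real m"
    define t where "t = (1 + vec_nth z i) / 2"
    have t: "0 \<le> t" "t \<le> 1" "vec_nth z i = 2 * t - 1"
      using cubeD[OF z, of i] by (auto simp: t_def field_simps)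
    have m1: "1 \<le> real m" "32 * K / e < real m"
      using m M0 by linarith+
    have bound: "norm (u (upd z i (\<xi> k)) - u z) \<le>
        (e / 2 + K * (8 / (real m)\<^sup>2)) + (K * (8 / (real m)\<^sup>2)) *\<^sub>R (real k - real m * t)\<^sup>2"
      if k: "k \<le> m" for k
    proof -
      let ?r = "\<bar>\<xi> k - vec_nth z i\<bar>"
      have in_cube: "upd z i (\<xi> k) \<in> cube"
        using \<xi>[OF k] z by (intro upd_in_cube) auto
      have 1: "norm (u (upd z i (\<xi> k)) - u z) \<le> e / 2 + K * ?r\<^sup>2"
      proof (cases "?r < d")
        case True
        then have "dist (u (upd z i (\<xi> k))) (u z) < e / 2"
          using d(2)[OF z in_cube] by (simp add: dist_upd)
        moreover have "0 \<le> K * ?r\<^sup>2"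
          using K by simp
        ultimately show ?thesis
          by (simp add: dist_norm)
      next
        case False
        have "norm (u (upd z i (\<xi> k)) - u z) \<le> 2 * B"
          using norm_triangle_ineq4[of "u (upd z i (\<xi> k))" "u z"] B(2)[OF z] B(2)[OF in_cube]
          by linarith
        also have "\<dots> \<le> K * ?r\<^sup>2"
        proof -
          have "d\<^sup>2 \<le> ?r\<^sup>2"
            using False d(1) by (intro power_mono) auto
          then have "2 * B * d\<^sup>2 \<le> 2 * B * ?r\<^sup>2"
            using B(1) by (intro mult_left_mono) auto
          then show ?thesis
            using d(1) by (simp add: K_def field_simps)
        qed
        finally show ?thesis
          using e by simp
      qed
      \<comment> \<open>The displacement splits into the deviation \<open>?a\<close> of the node
        from its equidistant position and the multiple \<open>?b\<close> of the binomial deviation,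
        whose square is averaged by \<open>casteljau_variance\<close>.\<close>
      let ?a = "\<xi> k - (2 * real k / real m - 1)" and ?b = "2 / real m * (real k - real m * t)"
      have "\<xi> k - vec_nth z i = ?a + ?b"
        using m1 by (simp add: t(3) field_simps)
      then have "?r\<^sup>2 = (?a + ?b)\<^sup>2"
        by (simp only: power2_abs)
      also have "\<dots> \<le> 2 * ?a\<^sup>2 + 2 * ?b\<^sup>2"
        by (rule square_sum_le)
      also have "?a\<^sup>2 \<le> (2 / real m)\<^sup>2"
        using \<xi>[OF k] by (intro abs_le_square_iff[THEN iffD1]) auto
      also have "2 * (2 / real m)\<^sup>2 + 2 * ?b\<^sup>2 =
          8 / (real m)\<^sup>2 + 8 / (real m)\<^sup>2 * (real k - real m * t)\<^sup>2"
        unfolding power_mult_distrib power_divide by simp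
      finally have "K * ?r\<^sup>2 \<le> K * (8 / (real m)\<^sup>2 + 8 / (real m)\<^sup>2 * (real k - real m * t)\<^sup>2)"
        using K by (intro mult_left_mono) auto
      with 1 show ?thesis
        by (simp add: algebra_simps)
    qed
    have "norm (casteljau m (\<lambda>k. u (upd z i (\<xi> k))) t - u z) =
        norm (casteljau m (\<lambda>k. u (upd z i (\<xi> k)) - u z) t)"
      by (simp add: casteljau_diff)
    also have "\<dots> \<le> casteljau m (\<lambda>k. (e / 2 + K * (8 / (real m)\<^sup>2)) +
        (K * (8 / (real m)\<^sup>2)) *\<^sub>R (real k - real m * t)\<^sup>2) t"
      using bound by (intro norm_casteljau_le t)
    also have "\<dots> = e / 2 + K * (8 / (real m)\<^sup>2) + K * (8 / (real m)\<^sup>2) * (real m * t * (1 - t))"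
      unfolding casteljau_add casteljau_scaleR casteljau_const casteljau_variance by simp
    also have "\<dots> \<le> e / 2 + K * (8 / real m) + K * (8 / (real m)\<^sup>2) * (real m * 1)"
    proof -
      have "8 / (real m)\<^sup>2 \<le> 8 / real m"
        using m1 by (simp add: field_simps power2_eq_square)
      moreover have "t * (1 - t) \<le> 1"
        using t by (intro mult_le_one) auto
      then have "real m * t * (1 - t) \<le> real m * 1"
        using m1 by (simp only: mult.assoc) (intro mult_left_mono, auto)
      ultimately show ?thesis
        using K by (intro add_mono mult_left_mono order_refl) auto
    qed
    also have "\<dots> = e / 2 + 16 * K / real m"
      using m1 by (simp add: field_simps power2_eq_square)
    also have "\<dots> \<le> e"
      using m1 e by (simp add: field_simps)
    finally show "norm (casteljau m (\<lambda>k. u (upd z i (\<xi> k))) ((1 + vec_nth z i) / 2) - u z) \<le> e"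
      by (simp add: t_def)
  qed
qed

section \<open>Closure properties of polynomial approximability together with the gradient\<close>

definition C1_approximable :: "(real^'n::finite \<Rightarrow> real) \<Rightarrow> (real^'n \<Rightarrow> real^'n) \<Rightarrow> bool" where
  "C1_approximable f f' \<longleftrightarrow> (\<forall>e>0. \<exists>p p'. real_polynomial_function p \<and> continuous_on UNIV p' \<and>
     (\<forall>x. (p has_derivative inner (p' x)) (at x)) \<and>
     (\<forall>x\<in>cube. \<bar>p x - f x\<bar> \<le> e \<and> norm (p' x - f' x) \<le> e))"

lemma C1_approximableE:
  assumes "C1_approximable f f'" "0 < e"
  obtains p p' where "real_polynomial_function p" "continuous_on UNIV p'"
     "\<And>x. (p has_derivative inner (p' x)) (at x)"
     "\<And>x. x \<in> cube \<Longrightarrow> \<bar>p x - f x\<bar> \<le> e" "\<And>x. x \<in> cube \<Longrightarrow> norm (p' x - f' x) \<le> e"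
  using assms unfolding C1_approximable_def by metis

lemma C1_approximable_const: "C1_approximable (\<lambda>x. a) (\<lambda>x. 0)"
  unfolding C1_approximable_def
proof (intro allI impI)
  fix e :: real assume "0 < e"
  have "((\<lambda>x. a) has_derivative inner 0) (at x)" for x :: "real^'n"
    by (rule has_derivative_eq_rhs[OF has_derivative_const]) auto
  then show "\<exists>p p'. real_polynomial_function p \<and> continuous_on UNIV p' \<and>
     (\<forall>x. (p has_derivative inner (p' x)) (at x)) \<and>
     (\<forall>x\<in>cube. \<bar>p x - a\<bar> \<le> e \<and> norm (p' x - (0::real^'n)) \<le> e)"
    using \<open>0 < e\<close> by (intro exI[of _ "\<lambda>x. a"] exI[of _ "\<lambda>x. 0"]) auto
qed

lemma C1_approximable_add:
  assumes f: "C1_approximable f f'" and g: "C1_approximable g g'"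
  shows "C1_approximable (\<lambda>x. f x + g x) (\<lambda>x. f' x + g' x)"
  unfolding C1_approximable_def
proof (intro allI impI)
  fix e :: real assume "0 < e"
  then have e: "0 < e / 2" by simp
  obtain p p' where p: "real_polynomial_function p" "continuous_on UNIV p'"
     "\<And>x. (p has_derivative inner (p' x)) (at x)"
     "\<And>x. x \<in> cube \<Longrightarrow> \<bar>p x - f x\<bar> \<le> e / 2" "\<And>x. x \<in> cube \<Longrightarrow> norm (p' x - f' x) \<le> e / 2"
    using C1_approximableE[OF f e] by metis
  obtain q q' where q: "real_polynomial_function q" "continuous_on UNIV q'"
     "\<And>x. (q has_derivative inner (q' x)) (at x)"
     "\<And>x. x \<in> cube \<Longrightarrow> \<bar>q x - g x\<bar> \<le> e / 2" "\<And>x. x \<in> cube \<Longrightarrow> norm (q' x - g' x) \<le> e / 2"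
    using C1_approximableE[OF g e] by metis
  have "((\<lambda>x. p x + q x) has_derivative inner (p' x + q' x)) (at x)" for x
    by (rule has_derivative_eq_rhs[OF has_derivative_add[OF p(3) q(3)]]) (auto simp: inner_add_left)
  moreover have "\<bar>p x + q x - (f x + g x)\<bar> \<le> e" if "x \<in> cube" for x
    using p(4)[OF that] q(4)[OF that] by linarith
  moreover have "norm (p' x + q' x - (f' x + g' x)) \<le> e" if "x \<in> cube" for x
    using norm_triangle_ineq[of "p' x - f' x" "q' x - g' x"] p(5)[OF that] q(5)[OF that]
    by (simp add: algebra_simps)
  ultimately show "\<exists>p p'. real_polynomial_function p \<and> continuous_on UNIV p' \<and>
     (\<forall>x. (p has_derivative inner (p' x)) (at x)) \<and>
     (\<forall>x\<in>cube. \<bar>p x - (f x + g x)\<bar> \<le> e \<and> norm (p' x - (f' x + g' x)) \<le> e)"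
    using p q by (intro exI[of _ "\<lambda>x. p x + q x"] exI[of _ "\<lambda>x. p' x + q' x"])
      (auto intro!: continuous_intros)
qed

text \<open>The product rule for the factors \<open>1 - t\<close> and \<open>t\<close> of the
  Bernstein recursion, where \<open>t\<close> is affine in one coordinate. The bounds by 1 keep the
  two error terms of the gradient at \<open>e / 2\<close> each.\<close>

lemma C1_approximable_mult_affine:
  fixes f :: "real^'n::finite \<Rightarrow> real"
  assumes f: "C1_approximable f f'"
    and ab: "\<And>x. x \<in> cube \<Longrightarrow> \<bar>a + b * vec_nth x i\<bar> \<le> 1" "\<bar>b\<bar> \<le> 1"
  shows "C1_approximable (\<lambda>x. (a + b * vec_nth x i) * f x)
    (\<lambda>x. (a + b * vec_nth x i) *\<^sub>R f' x + (f x * b) *\<^sub>R axis i 1)"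
  unfolding C1_approximable_def
proof (intro allI impI)
  fix e :: real assume "0 < e"
  then have e: "0 < e / 2" by simp
  obtain p p' where p: "real_polynomial_function p" "continuous_on UNIV p'"
     "\<And>x. (p has_derivative inner (p' x)) (at x)"
     "\<And>x. x \<in> cube \<Longrightarrow> \<bar>p x - f x\<bar> \<le> e / 2" "\<And>x. x \<in> cube \<Longrightarrow> norm (p' x - f' x) \<le> e / 2"
    using C1_approximableE[OF f e] by metis
  let ?l = "\<lambda>x. a + b * vec_nth x i"
  let ?q = "\<lambda>x. ?l x * p x" and ?q' = "\<lambda>x. ?l x *\<^sub>R p' x + (p x * b) *\<^sub>R axis i 1"
  have cont: "continuous_on UNIV p"
    using p(1) by (simp add: continuous_on_polymonial_function real_polynomial_function_eq)
  have lin: "bounded_linear (\<lambda>x::real^'n. vec_nth x i)"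
    by (rule bounded_linear_vec_nth)
  have poly: "real_polynomial_function ?q"
    by (intro real_polynomial_function.intros lin p(1))
  have "(?l has_derivative (\<lambda>h. b * vec_nth h i)) (at x)" for x :: "real^'n"
    by (auto intro!: derivative_eq_intros bounded_linear.has_derivative[OF lin])
  then have deriv: "(?q has_derivative inner (?q' x)) (at x)" for x
    by (rule has_derivative_eq_rhs[OF has_derivative_mult[OF _ p(3)]])
      (auto simp: inner_add_left inner_axis' algebra_simps)
  have close: "\<bar>?q x - ?l x * f x\<bar> \<le> e"
     "norm (?q' x - (?l x *\<^sub>R f' x + (f x * b) *\<^sub>R axis i 1)) \<le> e" if x: "x \<in> cube" for x
  proof -
    have "\<bar>?q x - ?l x * f x\<bar> = \<bar>?l x\<bar> * \<bar>p x - f x\<bar>"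
      by (simp add: abs_mult[symmetric] algebra_simps)
    also have "\<dots> \<le> 1 * (e / 2)"
      using ab(1)[OF x] p(4)[OF x] by (intro mult_mono) auto
    finally show "\<bar>?q x - ?l x * f x\<bar> \<le> e"
      using \<open>0 < e\<close> by simp
    have "?q' x - (?l x *\<^sub>R f' x + (f x * b) *\<^sub>R axis i 1) =
        ?l x *\<^sub>R (p' x - f' x) + ((p x - f x) * b) *\<^sub>R axis i 1"
      by (simp add: algebra_simps)
    also have "norm \<dots> \<le> \<bar>?l x\<bar> * norm (p' x - f' x) + \<bar>p x - f x\<bar> * \<bar>b\<bar>"
      by (rule order_trans[OF norm_triangle_ineq]) (simp add: abs_mult norm_axis_1)
    also have "\<dots> \<le> 1 * (e / 2) + (e / 2) * 1"
      using ab(1)[OF x] ab(2) p(4,5)[OF x] e by (intro add_mono mult_mono) auto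
    finally show "norm (?q' x - (?l x *\<^sub>R f' x + (f x * b) *\<^sub>R axis i 1)) \<le> e"
      by simp
  qed
  have "continuous_on UNIV ?q'"
    using cont p(2) by (intro continuous_intros)
  with poly deriv close show "\<exists>p p'. real_polynomial_function p \<and> continuous_on UNIV p' \<and>
     (\<forall>x. (p has_derivative inner (p' x)) (at x)) \<and>
     (\<forall>x\<in>cube. \<bar>p x - ?l x * f x\<bar> \<le> e \<and>
       norm (p' x - (?l x *\<^sub>R f' x + (f x * b) *\<^sub>R axis i 1)) \<le> e)"
    by (intro exI[of _ ?q] exI[of _ ?q']) auto
qed

text \<open>The triangle inequality. Since the gradient is a separate argument of
  \<open>C1_approximable\<close>, no theorem on differentiating limits is involved.\<close>

lemma C1_approximable_limit:
  assumes "\<And>e. 0 < e \<Longrightarrow> \<exists>g g'. C1_approximable g g' \<and>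
      (\<forall>x\<in>cube. \<bar>g x - f x\<bar> \<le> e \<and> norm (g' x - f' x) \<le> e)"
  shows "C1_approximable f f'"
  unfolding C1_approximable_def
proof (intro allI impI)
  fix e :: real assume "0 < e"
  then have e: "0 < e / 2" by simp
  obtain g g' where g: "C1_approximable g g'"
    "\<And>x. x \<in> cube \<Longrightarrow> \<bar>g x - f x\<bar> \<le> e / 2 \<and> norm (g' x - f' x) \<le> e / 2"
    using assms[OF e] by auto
  obtain p p' where p: "real_polynomial_function p" "continuous_on UNIV p'"
     "\<And>x. (p has_derivative inner (p' x)) (at x)"
     "\<And>x. x \<in> cube \<Longrightarrow> \<bar>p x - g x\<bar> \<le> e / 2" "\<And>x. x \<in> cube \<Longrightarrow> norm (p' x - g' x) \<le> e / 2"
    using C1_approximableE[OF g(1) e] by metis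
  have "\<bar>p x - f x\<bar> \<le> e" "norm (p' x - f' x) \<le> e" if "x \<in> cube" for x
    using p(4)[OF that] g(2)[OF that] p(5)[OF that]
      norm_triangle_ineq[of "p' x - g' x" "g' x - f' x"]
    by (linarith, simp)
  then show "\<exists>p p'. real_polynomial_function p \<and> continuous_on UNIV p' \<and>
     (\<forall>x. (p has_derivative inner (p' x)) (at x)) \<and>
     (\<forall>x\<in>cube. \<bar>p x - f x\<bar> \<le> e \<and> norm (p' x - f' x) \<le> e)"
    using p by blast
qed

text \<open>The defining recursion, multiplied by \<open>m / 2\<close> so that it also covers
  \<open>m = 0\<close>, where \<open>m - 1\<close> truncates to \<open>0\<close> and both sides
  vanish.\<close>

lemma casteljau_rec:
  fixes d :: "nat \<Rightarrow> real"
  shows "m / 2 * casteljau m d t =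
    (1 - t) * (m / 2 * casteljau (m - 1) d t) + t * (m / 2 * casteljau (m - 1) (\<lambda>k. d (Suc k)) t)"
proof (cases m)
  case (Suc n)
  have "r / 2 * ((1 - t) * a + t * b) = (1 - t) * (r / 2 * a) + t * (r / 2 * b)" for r a b
    by (simp add: field_simps)
  then show ?thesis
    unfolding Suc by simp
qed simp

text \<open>The coefficients are themselves functions of \<open>x\<close>. Hence the gradient has
  two parts: the averaged gradients of the coefficients, and the derivative of the Bernstein
  polynomial, which is \<open>m\<close> times the polynomial of degree \<open>m - 1\<close> of the
  forward differences. The factor \<open>1 / 2\<close> is the derivative of the parameter in the
  coordinate \<open>i\<close>.\<close>

lemma C1_approximable_casteljau:
  fixes c :: "nat \<Rightarrow> real^'n::finite \<Rightarrow> real"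
  assumes "\<And>k. k \<le> m \<Longrightarrow> C1_approximable (c k) (c' k)"
  shows "C1_approximable (\<lambda>x. casteljau m (\<lambda>k. c k x) ((1 + vec_nth x i) / 2))
    (\<lambda>x. casteljau m (\<lambda>k. c' k x) ((1 + vec_nth x i) / 2) +
       (m / 2 * casteljau (m - 1) (\<lambda>k. c (Suc k) x - c k x) ((1 + vec_nth x i) / 2)) *\<^sub>R axis i 1)"
  using assms
proof (induction m arbitrary: c c')
  case (Suc m)
  let ?t = "\<lambda>x. (1 + vec_nth x i) / 2"
  let ?D = "\<lambda>c c' x. casteljau m (\<lambda>k. c' k x) (?t x) +
       (m / 2 * casteljau (m - 1) (\<lambda>k. c (Suc k) x - c k x) (?t x)) *\<^sub>R axis i 1"
  let ?F = "\<lambda>c x. casteljau m (\<lambda>k. c k x) (?t x)"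
  have "C1_approximable (?F c) (?D c c')"
    by (rule Suc.IH) (simp add: Suc.prems)
  then have 1: "C1_approximable (\<lambda>x. (1 / 2 + - 1 / 2 * vec_nth x i) * ?F c x)
     (\<lambda>x. (1 / 2 + - 1 / 2 * vec_nth x i) *\<^sub>R ?D c c' x + (?F c x * (- 1 / 2)) *\<^sub>R axis i 1)"
    by (rule C1_approximable_mult_affine) (auto simp: abs_le_iff dest!: cubeD[where i = i])
  have "C1_approximable (?F (\<lambda>k. c (Suc k))) (?D (\<lambda>k. c (Suc k)) (\<lambda>k. c' (Suc k)))"
    by (rule Suc.IH) (simp add: Suc.prems)
  then have 2: "C1_approximable (\<lambda>x. (1 / 2 + 1 / 2 * vec_nth x i) * ?F (\<lambda>k. c (Suc k)) x)
     (\<lambda>x. (1 / 2 + 1 / 2 * vec_nth x i) *\<^sub>R ?D (\<lambda>k. c (Suc k)) (\<lambda>k. c' (Suc k)) x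
        + (?F (\<lambda>k. c (Suc k)) x * (1 / 2)) *\<^sub>R axis i 1)"
    by (rule C1_approximable_mult_affine) (auto simp: abs_le_iff dest!: cubeD[where i = i])
  have t: "1 / 2 + - 1 / 2 * vec_nth x i = 1 - ?t x" "1 / 2 + 1 / 2 * vec_nth x i = ?t x" for x :: "real^'n"
    by (simp_all add: field_simps)
  \<comment> \<open>The product rule contributes half the difference of the two \<open>?F\<close>
    terms. This is one more half copy of the averaged forward differences, which raises the factor
    \<open>m / 2\<close> to \<open>Suc m / 2\<close>.\<close>
  have D: "(1 - ?t x) *\<^sub>R ?D c c' x + (?F c x * (- 1 / 2)) *\<^sub>R axis i 1 +
     (?t x *\<^sub>R ?D (\<lambda>k. c (Suc k)) (\<lambda>k. c' (Suc k)) x + (?F (\<lambda>k. c (Suc k)) x * (1 / 2)) *\<^sub>R axis i 1)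
     = casteljau (Suc m) (\<lambda>k. c' k x) (?t x) +
       (Suc m / 2 * casteljau m (\<lambda>k. c (Suc k) x - c k x) (?t x)) *\<^sub>R axis i 1" for x
  proof -
    have "m / 2 * casteljau m (\<lambda>k. c (Suc k) x - c k x) (?t x) =
      (1 - ?t x) * (m / 2 * casteljau (m - 1) (\<lambda>k. c (Suc k) x - c k x) (?t x)) +
      ?t x * (m / 2 * casteljau (m - 1) (\<lambda>k. c (Suc (Suc k)) x - c (Suc k) x) (?t x))"
      by (rule casteljau_rec)
    moreover have "Suc m / 2 * casteljau m (\<lambda>k. c (Suc k) x - c k x) (?t x) =
       m / 2 * casteljau m (\<lambda>k. c (Suc k) x - c k x) (?t x) + (?F (\<lambda>k. c (Suc k)) x - ?F c x) / 2"
      by (simp add: casteljau_diff algebra_simps add_divide_distrib diff_divide_distrib)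
    ultimately have eq: "Suc m / 2 * casteljau m (\<lambda>k. c (Suc k) x - c k x) (?t x) =
      (1 - ?t x) * (m / 2 * casteljau (m - 1) (\<lambda>k. c (Suc k) x - c k x) (?t x)) +
      ?t x * (m / 2 * casteljau (m - 1) (\<lambda>k. c (Suc (Suc k)) x - c (Suc k) x) (?t x)) +
      (?F c x * (- 1 / 2)) + (?F (\<lambda>k. c (Suc k)) x * (1 / 2))"
      by (simp add: diff_divide_distrib)
    show ?thesis
      unfolding eq by (simp only: casteljau.simps scaleR_add_right scaleR_add_left scaleR_scaleR) simp
  qed
  show ?case
    using C1_approximable_add[OF 1 2] unfolding t D by simp
qed simp

section \<open>Induction over the coordinates\<close>

definition merge :: "'n set \<Rightarrow> real^'n::finite \<Rightarrow> real^'n \<Rightarrow> real^'n" where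
  "merge S x c = (\<chi> j. if j \<in> S then vec_nth x j else vec_nth c j)"

definition restrict_coords :: "'n set \<Rightarrow> real^'n::finite \<Rightarrow> real^'n" where
  "restrict_coords S v = (\<chi> j. if j \<in> S then vec_nth v j else 0)"

lemma linear_restrict_coords: "linear (restrict_coords S)"
  by (auto intro!: linearI simp: restrict_coords_def Finite_Cartesian_Product.vec_eq_iff)

lemma norm_restrict_coords_le: "norm (restrict_coords S v) \<le> norm v"
  by (rule norm_le_componentwise_cart) (simp add: restrict_coords_def)

lemma restrict_coords_insert:
  "i \<notin> S \<Longrightarrow> restrict_coords (insert i S) v = restrict_coords S v + vec_nth v i *\<^sub>R axis i 1"
  by (auto simp: restrict_coords_def Finite_Cartesian_Product.vec_eq_iff axis_def)

text \<open>The mean value theorem on a segment parallel to an axis. As \<open>f\<close> is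
  differentiable only within the cube, the chain rule is applied relative to the image of the
  segment.\<close>

lemma upd_mvt:
  fixes f :: "real^'n::finite \<Rightarrow> real"
  assumes f: "\<And>x. x \<in> cube \<Longrightarrow> (f has_derivative inner (f' x)) (at x within cube)"
    and z: "z \<in> cube" and st: "-1 \<le> s" "s < t" "t \<le> 1"
  obtains \<xi> where "s \<le> \<xi>" "\<xi> \<le> t"
    "f (upd z i t) - f (upd z i s) = (t - s) * vec_nth (f' (upd z i \<xi>)) i"
proof -
  have deriv: "((\<lambda>r. f (upd z i r)) has_derivative (\<lambda>h. h * vec_nth (f' (upd z i r)) i)) (at r within {s..t})"
    if r: "r \<in> {s..t}" for r
  proof -
    have "((\<lambda>r. upd z i r) has_derivative (\<lambda>h. h *\<^sub>R axis i 1)) (at r within {s..t})"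
      unfolding upd_def by (auto intro!: derivative_eq_intros)
    moreover have "(f has_derivative inner (f' (upd z i r))) (at (upd z i r) within (\<lambda>r. upd z i r) ` {s..t})"
      by (rule has_derivative_subset[OF f]) (use z st r in \<open>auto intro!: upd_in_cube\<close>)
    ultimately have "((\<lambda>r. f (upd z i r)) has_derivative (\<lambda>h. inner (f' (upd z i r)) (h *\<^sub>R axis i 1)))
        (at r within {s..t})"
      by (rule has_derivative_in_compose)
    then show ?thesis
      by (simp add: inner_axis)
  qed
  then have "\<exists>\<xi>\<in>{s<..<t}. f (upd z i t) - f (upd z i s) = (t - s) * vec_nth (f' (upd z i \<xi>)) i"
    using st(2) by (intro mvt_simple) auto
  then obtain \<xi> where "\<xi> \<in> {s<..<t}"
    "f (upd z i t) - f (upd z i s) = (t - s) * vec_nth (f' (upd z i \<xi>)) i"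
    by blast
  then show thesis
    by (intro that[of \<xi>]) auto
qed

text \<open>Coordinates outside \<open>S\<close> are frozen at \<open>c\<close>, and the induction
  frees one coordinate at a time. To free \<open>i\<close>, take the Bernstein polynomial in that
  coordinate: its coefficients are functions with coordinate \<open>i\<close> frozen at a node,
  hence approximable by the induction hypothesis for a modified \<open>c\<close>.\<close>

lemma C1_approximable_merge:
  fixes f :: "real^'n::finite \<Rightarrow> real"
  assumes f': "continuous_on cube f'"
    and f: "\<And>x. x \<in> cube \<Longrightarrow> (f has_derivative inner (f' x)) (at x within cube)"
    and "finite S" "c \<in> cube"
  shows "C1_approximable (\<lambda>x. f (merge S x c)) (\<lambda>x. restrict_coords S (f' (merge S x c)))"
  using assms(3,4)
proof (induction S arbitrary: c rule: finite_induct)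
  case empty
  have "merge {} x c = c" "restrict_coords {} v = 0" for x v :: "real^'n"
    by (auto simp: merge_def restrict_coords_def Finite_Cartesian_Product.vec_eq_iff)
  then show ?case
    by (simp add: C1_approximable_const)
next
  case (insert i S)
  have cont: "continuous_on cube f"
    using f has_derivative_continuous continuous_on_eq_continuous_within by blast
  have upd_merge: "merge S x (upd c i s) = upd (merge (insert i S) x c) i s" for x s
    using insert.hyps by (auto simp: merge_def vec_nth_upd Finite_Cartesian_Product.vec_eq_iff)
  have merge_i: "vec_nth (merge (insert i S) x c) i = vec_nth x i" for x
    by (simp add: merge_def)
  have merge_cube: "merge (insert i S) x c \<in> cube" if "x \<in> cube" for x
    using that insert.prems by (auto simp: cube_iff merge_def)
  show ?case
  proof (rule C1_approximable_limit)
    fix e :: real assume "0 < e"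
    then have e: "0 < e / 2" by simp
    obtain M1 where M1: "\<And>m \<xi> z. M1 \<le> m \<Longrightarrow> z \<in> cube \<Longrightarrow>
      (\<And>k. k \<le> m \<Longrightarrow> \<xi> k \<in> {-1..1} \<and> \<bar>\<xi> k - (2 * real k / real m - 1)\<bar> \<le> 2 / real m) \<Longrightarrow>
      norm (casteljau m (\<lambda>k. f (upd z i (\<xi> k))) ((1 + vec_nth z i) / 2) - f z) \<le> e"
      using casteljau_tendsto[OF cont \<open>0 < e\<close>, of i] by metis
    obtain M2 where M2: "\<And>m \<xi> z. M2 \<le> m \<Longrightarrow> z \<in> cube \<Longrightarrow>
      (\<And>k. k \<le> m \<Longrightarrow> \<xi> k \<in> {-1..1} \<and> \<bar>\<xi> k - (2 * real k / real m - 1)\<bar> \<le> 2 / real m) \<Longrightarrow>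
      norm (casteljau m (\<lambda>k. f' (upd z i (\<xi> k))) ((1 + vec_nth z i) / 2) - f' z) \<le> e / 2"
      using casteljau_tendsto[OF f' e, of i] by metis
    \<comment> \<open>The polynomial has degree \<open>Suc n\<close> and its derivative in
      coordinate \<open>i\<close> is an average of degree \<open>n\<close>, so both degrees have to
      reach the threshold \<open>M2\<close> for \<open>f'\<close>.\<close>
    define n where "n = Suc (max M1 M2)"
    define \<nu> where "\<nu> k = 2 * real k / real (Suc n) - 1" for k
    have n: "0 < n" "M1 \<le> Suc n" "M2 \<le> Suc n" "M2 \<le> n"
      by (auto simp: n_def)
    have \<nu>: "\<nu> k \<in> {-1..1}" if "k \<le> Suc n" for k
      using that by (simp add: \<nu>_def field_simps)
    let ?z = "\<lambda>x. merge (insert i S) x c" and ?t = "\<lambda>x. (1 + vec_nth x i) / 2"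
    define g where "g x = casteljau (Suc n) (\<lambda>k. f (upd (?z x) i (\<nu> k))) (?t x)" for x
    define g' where "g' x = casteljau (Suc n) (\<lambda>k. restrict_coords S (f' (upd (?z x) i (\<nu> k)))) (?t x) +
       (Suc n / 2 * casteljau n (\<lambda>k. f (upd (?z x) i (\<nu> (Suc k))) - f (upd (?z x) i (\<nu> k))) (?t x)) *\<^sub>R axis i 1" for x
    have "C1_approximable (\<lambda>x. f (merge S x (upd c i (\<nu> k))))
        (\<lambda>x. restrict_coords S (f' (merge S x (upd c i (\<nu> k)))))" if "k \<le> Suc n" for k
      using insert.IH[OF upd_in_cube[OF insert.prems \<nu>[OF that]]] .
    from C1_approximable_casteljau[where m = "Suc n" and i = i, OF this]
    have approx: "C1_approximable g g'"
      by (simp only: g_def[abs_def] g'_def[abs_def] upd_merge diff_Suc_1)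
    have "\<bar>g x - f (?z x)\<bar> \<le> e" "norm (g' x - restrict_coords (insert i S) (f' (?z x))) \<le> e"
      if x: "x \<in> cube" for x
    proof -
      have "\<nu> k \<in> {-1..1} \<and> \<bar>\<nu> k - (2 * real k / real (Suc n) - 1)\<bar> \<le> 2 / real (Suc n)" if "k \<le> Suc n" for k
        using \<nu>[OF that] by (simp add: \<nu>_def)
      note M = M1[OF n(2) merge_cube[OF x] this] M2[OF n(3) merge_cube[OF x] this]
      show "\<bar>g x - f (?z x)\<bar> \<le> e"
        using M(1) unfolding g_def merge_i by (simp only: real_norm_def)
      \<comment> \<open>Restriction to the coordinates in \<open>S\<close> is linear and does not
        increase the norm, so it inherits the bound for the full gradient.\<close>
      have 1: "norm (casteljau (Suc n) (\<lambda>k. restrict_coords S (f' (upd (?z x) i (\<nu> k)))) (?t x)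
          - restrict_coords S (f' (?z x))) \<le> e / 2"
        unfolding casteljau_linear[OF linear_restrict_coords] linear_diff[OF linear_restrict_coords, symmetric]
        using M(2) norm_restrict_coords_le order_trans unfolding merge_i by blast
      \<comment> \<open>Adjacent nodes are \<open>2 / Suc n\<close> apart; this cancels the factor
        \<open>Suc n / 2\<close> and leaves values of the partial derivative.\<close>
      have "\<exists>\<xi>. \<nu> k \<le> \<xi> \<and> \<xi> \<le> \<nu> (Suc k) \<and> f (upd (?z x) i (\<nu> (Suc k))) - f (upd (?z x) i (\<nu> k)) =
         2 / Suc n * vec_nth (f' (upd (?z x) i \<xi>)) i" if k: "k \<le> n" for k
      proof -
        have "2 * real (Suc k) / real (Suc n) = 2 * real k / real (Suc n) + 2 / real (Suc n)"
          by (simp add: add_divide_distrib[symmetric])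
        then have "\<nu> (Suc k) - \<nu> k = 2 / Suc n"
          unfolding \<nu>_def by linarith
        moreover have "-1 \<le> \<nu> k" "\<nu> (Suc k) \<le> 1"
          using \<nu>[of k] \<nu>[of "Suc k"] k by auto
        moreover have "\<nu> k < \<nu> (Suc k)"
          by (simp add: \<nu>_def divide_strict_right_mono)
        ultimately show ?thesis
          using upd_mvt[OF f merge_cube[OF x], of "\<nu> k" "\<nu> (Suc k)" i] by metis
      qed
      then obtain \<xi> where \<xi>: "\<And>k. k \<le> n \<Longrightarrow> \<nu> k \<le> \<xi> k \<and> \<xi> k \<le> \<nu> (Suc k)"
        "\<And>k. k \<le> n \<Longrightarrow> f (upd (?z x) i (\<nu> (Suc k))) - f (upd (?z x) i (\<nu> k)) =
         2 / Suc n * vec_nth (f' (upd (?z x) i (\<xi> k))) i"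
        by metis
      \<comment> \<open>The intermediate points belong to nodes of degree \<open>Suc n\<close> but
        are used at degree \<open>n\<close>. For \<open>k \<le> n\<close> the node
        \<open>2 * k / n - 1\<close> lies between \<open>\<nu> k\<close> and
        \<open>\<nu> (Suc k)\<close> as well, and this interval has length at most
        \<open>2 / n\<close>.\<close>
      have near: "\<xi> k \<in> {-1..1} \<and> \<bar>\<xi> k - (2 * real k / real n - 1)\<bar> \<le> 2 / real n" if k: "k \<le> n" for k
      proof -
        have kn: "real k \<le> real n" "0 < real n"
          using k n(1) by auto
        have a: "2 * real k / real (Suc n) \<le> 2 * real k / real n"
          using kn by (intro divide_left_mono) auto
        have b: "2 * real k / real n \<le> 2 * real (Suc k) / real (Suc n)"
          using kn by (simp add: field_simps)
        have "2 * real (Suc k) / real (Suc n) = 2 * real k / real (Suc n) + 2 / real (Suc n)"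
          by (simp add: add_divide_distrib[symmetric])
        moreover have "2 / real (Suc n) \<le> 2 / real n"
          using kn by (intro divide_left_mono) auto
        ultimately have c: "2 * real (Suc k) / real (Suc n) - 2 * real k / real (Suc n) \<le> 2 / real n"
          by linarith
        have "\<xi> k \<in> {-1..1}"
          using \<xi>(1)[OF k] \<nu>[of k] \<nu>[of "Suc k"] k by auto
        moreover have "\<bar>\<xi> k - (2 * real k / real n - 1)\<bar> \<le> 2 / real n"
          using \<xi>(1)[OF k, unfolded \<nu>_def] a b c by linarith
        ultimately show ?thesis ..
      qed
      note M' = M2[OF n(4) merge_cube[OF x] near]
      have "Suc n / 2 * casteljau n (\<lambda>k. f (upd (?z x) i (\<nu> (Suc k))) - f (upd (?z x) i (\<nu> k))) (?t x) =
          Suc n / 2 * casteljau n (\<lambda>k. (2 / Suc n) *\<^sub>R vec_nth (f' (upd (?z x) i (\<xi> k))) i) (?t x)"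
        using \<xi>(2) by (intro arg_cong2[of _ _ _ _ "(*)"] casteljau_cong refl) simp
      also have "\<dots> = vec_nth (casteljau n (\<lambda>k. f' (upd (?z x) i (\<xi> k))) (?t x)) i"
        by (simp add: casteljau_scaleR[of n "2 / Suc n"] casteljau_linear[of "\<lambda>v. vec_nth v i"]
            bounded_linear.linear[OF bounded_linear_vec_nth] del: of_nat_Suc real_scaleR_def)
          simp
      finally have 2: "\<bar>Suc n / 2 * casteljau n (\<lambda>k. f (upd (?z x) i (\<nu> (Suc k))) - f (upd (?z x) i (\<nu> k))) (?t x)
          - vec_nth (f' (?z x)) i\<bar> \<le> e / 2"
        using order_trans[OF component_le_norm_cart M'] unfolding merge_i
        by (simp only: vector_minus_component)
      have "g' x - restrict_coords (insert i S) (f' (?z x)) =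
        (casteljau (Suc n) (\<lambda>k. restrict_coords S (f' (upd (?z x) i (\<nu> k)))) (?t x)
          - restrict_coords S (f' (?z x))) +
        (Suc n / 2 * casteljau n (\<lambda>k. f (upd (?z x) i (\<nu> (Suc k))) - f (upd (?z x) i (\<nu> k))) (?t x)
          - vec_nth (f' (?z x)) i) *\<^sub>R axis i 1"
        unfolding g'_def restrict_coords_insert[OF insert.hyps(2)] by (simp only: scaleR_diff_left) simp
      also have "norm \<dots> \<le> e / 2 + e / 2"
        using 1 2 by (intro norm_triangle_mono) (auto simp: norm_axis_1)
      finally show "norm (g' x - restrict_coords (insert i S) (f' (?z x))) \<le> e"
        by simp
    qed
    with approx show "\<exists>g g'. C1_approximable g g' \<and> (\<forall>x\<in>cube. \<bar>g x - f (?z x)\<bar> \<le> e \<and>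
        norm (g' x - restrict_coords (insert i S) (f' (?z x))) \<le> e)"
      by blast
  qed
qed

theorem C1_weierstrass_cube:
  fixes f :: "real^'n::finite \<Rightarrow> real"
  assumes "continuous_on cube f'"
    and "\<And>x. x \<in> cube \<Longrightarrow> (f has_derivative inner (f' x)) (at x within cube)"
  shows "C1_approximable f f'"
proof -
  have "merge UNIV x c = x" "restrict_coords UNIV v = v" for x c v :: "real^'n"
    by (auto simp: merge_def restrict_coords_def)
  moreover have "0 \<in> (cube :: (real^'n) set)"
    by (simp add: cube_iff)
  ultimately show ?thesis
    using C1_approximable_merge[OF assms, of UNIV 0] by simp
qed

section \<open>Polynomials as RePU networks\<close>

definition bounded_layer :: "layer \<Rightarrow> bool" where
  "bounded_layer l \<longleftrightarrow>
    (\<forall>i<dim_row (fst l). \<forall>j<dim_col (fst l). fst l $$ (i, j) \<in> {-1..1}) \<and>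
    (\<forall>i<dim_vec (snd l). vec_index (snd l) i \<in> {-1..1})"

lemma set_layer_params: "bounded_layer l \<Longrightarrow> set (layer_params l) \<subseteq> {-1..1}"
  by (auto simp: bounded_layer_def layer_params_def set_list_of_vec vec_set_def)

lemma hidden_dims_append:
  "hidden_dims n w ls \<Longrightarrow> layer_dims w k l \<Longrightarrow> 0 < k \<Longrightarrow> hidden_dims n k (ls @ [l])"
  by (induction ls arbitrary: n) auto

lemma hidden_output_append:
  "hidden_output (ls @ [l]) z = map_vec RePU (affine_layer l (hidden_output ls z))"
  by (induction ls arbitrary: z) auto

text \<open>Each use of \<open>add\<close> stands for one neuron with one outgoing weight. The same
  neuron may be added repeatedly, so only the single weights are bounded, not the total
  coefficient.\<close>

inductive neuron_span :: "('x \<Rightarrow> real) set \<Rightarrow> ('x \<Rightarrow> real) \<Rightarrow> bool" for T where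
  zero: "neuron_span T (\<lambda>x. 0)"
| add: "\<phi> \<in> T \<Longrightarrow> \<bar>c\<bar> \<le> 1 \<Longrightarrow> neuron_span T f \<Longrightarrow> neuron_span T (\<lambda>x. c * \<phi> x + f x)"

lemma neuron_span_base: "\<phi> \<in> T \<Longrightarrow> neuron_span T \<phi>"
  using neuron_span.add[OF _ _ neuron_span.zero, of \<phi> T 1] by simp

lemma neuron_span_add: "neuron_span T f \<Longrightarrow> neuron_span T g \<Longrightarrow> neuron_span T (\<lambda>x. f x + g x)"
  by (induction rule: neuron_span.induct) (auto simp: add.assoc intro: neuron_span.add)

lemma neuron_span_scale_le_1: "neuron_span T f \<Longrightarrow> \<bar>a\<bar> \<le> 1 \<Longrightarrow> neuron_span T (\<lambda>x. a * f x)"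
proof (induction rule: neuron_span.induct)
  case (add \<phi> c f)
  have "\<bar>a * c\<bar> \<le> 1"
    using add.hyps(2) add.prems by (simp add: abs_mult mult_le_one)
  then show ?case
    using neuron_span.add[OF add.hyps(1) _ add.IH[OF add.prems], of "a * c"] by (simp add: algebra_simps)
qed (auto intro: neuron_span.zero)

text \<open>Repeating neurons makes the span a vector space although the coefficients are bounded by \<open>1\<close>.\<close>

lemma neuron_span_scale:
  assumes "neuron_span T f"
  shows "neuron_span T (\<lambda>x. a * f x)"
proof -
  obtain n :: nat where n: "\<bar>a\<bar> < real n"
    using reals_Archimedean2 by blast
  then have "\<bar>a / real n\<bar> \<le> 1"
    by (simp add: field_simps)
  then have "neuron_span T (\<lambda>x. a / real n * f x)"
    using assms by (intro neuron_span_scale_le_1)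
  then have "neuron_span T (\<lambda>x. real k * (a / real n * f x))" for k
  proof (induction k)
    case (Suc k)
    then show ?case
      using neuron_span_add[OF Suc.prems Suc.IH[OF Suc.prems]]
      by (simp only: of_nat_Suc distrib_right mult_1_left)
  qed (simp add: neuron_span.zero)
  from this[of n] show ?thesis
    using n by simp
qed

lemma neuron_span_diff: "neuron_span T f \<Longrightarrow> neuron_span T g \<Longrightarrow> neuron_span T (\<lambda>x. f x - g x)"
  using neuron_span_add[of T f "\<lambda>x. - 1 * g x"] neuron_span_scale[of T g "-1"] by simp

lemma neuron_span_sum:
  "finite I \<Longrightarrow> (\<And>i. i \<in> I \<Longrightarrow> neuron_span T (f i)) \<Longrightarrow> neuron_span T (\<lambda>x. \<Sum>i\<in>I. f i x)"
  by (induction I rule: finite_induct) (auto intro: neuron_span.zero neuron_span_add)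

text \<open>The functions that a neuron of hidden layer \<open>L\<close> (counted from 0) may
  compute. Beyond the first layer the bias is absorbed in the span, which contains the
  constants.\<close>

primrec neurons :: "nat \<Rightarrow> (real^'n::finite \<Rightarrow> real) set" where
  "neurons 0 = {\<lambda>x. RePU ((\<Sum>j\<in>UNIV. a j * vec_nth x j) + b) | a b. (\<forall>j. a j \<in> {-1..1}) \<and> b \<in> {-1..1}}"
| "neurons (Suc L) = {\<lambda>x. RePU (f x) | f. neuron_span (neurons L) f}"

declare neurons.simps [simp del]

lemma neurons_0I:
  "(\<And>j. a j \<in> {-1..1}) \<Longrightarrow> b \<in> {-1..1} \<Longrightarrow> (\<lambda>x. RePU ((\<Sum>j\<in>UNIV. a j * vec_nth x j) + b)) \<in> neurons 0"
  unfolding neurons.simps by blast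

lemma neurons_SucI: "neuron_span (neurons L) f \<Longrightarrow> (\<lambda>x. RePU (f x)) \<in> neurons (Suc L)"
  by (auto simp: neurons.simps)

lemma RePU_1: "RePU 1 = 1"
  by (simp add: RePU_def)

text \<open>\<open>RePU\<close> fixes 1, so this constant passes through every layer.\<close>

lemma one_in_neurons: "(\<lambda>x. 1) \<in> neurons L"
proof (induction L)
  case 0
  show ?case
    using neurons_0I[of "\<lambda>j. 0" 1] by (simp add: RePU_1)
next
  case (Suc L)
  show ?case
    using neurons_SucI[OF neuron_span_base[OF Suc.IH]] by (simp add: RePU_1)
qed

lemma neuron_span_const: "neuron_span (neurons L) (\<lambda>x. c)"
  using neuron_span_scale[OF neuron_span_base[OF one_in_neurons], of L c] by simp

lemma RePU_square: "t\<^sup>2 = RePU t + RePU (- t)"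
  by (simp add: RePU_def max_def)

lemma neuron_span_square:
  assumes "neuron_span (neurons L) f"
  shows "neuron_span (neurons (Suc L)) (\<lambda>x. (f x)\<^sup>2)"
proof -
  have "neuron_span (neurons L) (\<lambda>x. - f x)"
    using neuron_span_scale[OF assms, of "- 1"] by simp
  then show ?thesis
    unfolding RePU_square
    using neuron_span_add[OF neuron_span_base[OF neurons_SucI[OF assms]] neuron_span_base[OF neurons_SucI]]
    by blast
qed

text \<open>Polarization; each product costs one layer.\<close>

lemma neuron_span_mult:
  assumes f: "neuron_span (neurons L) f" and g: "neuron_span (neurons L) g"
  shows "neuron_span (neurons (Suc L)) (\<lambda>x. f x * g x)"
proof -
  have eq: "f x * g x = 1 / 4 * ((f x + g x)\<^sup>2 - (f x - g x)\<^sup>2)" for x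
    by (simp add: power2_eq_square algebra_simps)
  show ?thesis
    unfolding eq
    by (intro neuron_span_scale neuron_span_diff neuron_span_square neuron_span_add f g)
qed

text \<open>Multiplication by the constant 1 carries a function to the next layer. This brings the
  operands of sums and products to a common depth.\<close>

lemma neuron_span_mono:
  assumes "neuron_span (neurons L) f" "L \<le> L'"
  shows "neuron_span (neurons L') f"
  using assms(2)
proof (induction rule: dec_induct)
  case (step L')
  show ?case
    using neuron_span_mult[OF step.IH neuron_span_const[of _ 1]] by simp
qed (rule assms(1))

text \<open>Polarization of the product of the coordinate with 1. The squares of
  \<open>vec_nth x i + 1\<close> and \<open>vec_nth x i - 1\<close> split into first-layer neurons
  whose nonzero weights and biases are 1 or -1.\<close>

lemma neuron_span_coord: "neuron_span (neurons 0) (\<lambda>x::real^'n::finite. vec_nth x i)"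
proof -
  have neuron: "(\<lambda>x::real^'n. RePU (s * vec_nth x i + b)) \<in> neurons 0"
    if "s \<in> {-1..1}" "b \<in> {-1..1}" for s b
  proof -
    have "(\<Sum>j\<in>UNIV. (if j = i then s else 0) * vec_nth x j) = s * vec_nth x i" for x :: "real^'n"
      by (simp add: if_distrib[of "\<lambda>c. c * _"] cong: if_cong)
    then show ?thesis
      using neurons_0I[of "\<lambda>j. if j = i then s else 0" b] that by simp
  qed
  have eq: "vec_nth x i = 1 / 4 * ((RePU (1 * vec_nth x i + 1) + RePU (- 1 * vec_nth x i + - 1))
      - (RePU (1 * vec_nth x i + - 1) + RePU (- 1 * vec_nth x i + 1)))" for x :: "real^'n"
    using RePU_square[of "vec_nth x i + 1"] RePU_square[of "vec_nth x i - 1"]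
    by (simp add: power2_eq_square algebra_simps)
  have "neuron_span (neurons 0) (\<lambda>x::real^'n.
      1 / 4 * ((RePU (1 * vec_nth x i + 1) + RePU (- 1 * vec_nth x i + - 1))
      - (RePU (1 * vec_nth x i + - 1) + RePU (- 1 * vec_nth x i + 1))))"
    by (intro neuron_span_scale neuron_span_diff neuron_span_add neuron_span_base neuron) auto
  then show ?thesis
    by (simp only: eq[symmetric])
qed

lemma polynomial_in_neuron_span:
  fixes p :: "real^'n::finite \<Rightarrow> real"
  assumes "real_polynomial_function p"
  shows "\<exists>L. neuron_span (neurons L) p"
  using assms
proof (induction rule: real_polynomial_function.induct)
  case (linear f)
  have eq: "f = (\<lambda>x. \<Sum>i\<in>UNIV. f (axis i 1) * vec_nth x i)"
  proof
    fix x
    have "f x = f (\<Sum>i\<in>UNIV. vec_nth x i *\<^sub>R axis i 1)"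
      using basis_expansion[of x] by (simp add: scalar_mult_eq_scaleR)
    then show "f x = (\<Sum>i\<in>UNIV. f (axis i 1) * vec_nth x i)"
      using bounded_linear.linear[OF linear] by (simp add: linear_sum linear_scale mult.commute)
  qed
  have "neuron_span (neurons 0) f"
    by (subst eq) (intro neuron_span_sum neuron_span_scale neuron_span_coord, simp)
  then show ?case ..
next
  case (const c)
  show ?case
    using neuron_span_const by blast
next
  case (add f g)
  then obtain L L' where "neuron_span (neurons L) f" "neuron_span (neurons L') g"
    by blast
  then show ?case
    using neuron_span_add[OF neuron_span_mono[of L f "max L L'"] neuron_span_mono[of L' g "max L L'"]]
    by auto
next
  case (mult f g)
  then obtain L L' where "neuron_span (neurons L) f" "neuron_span (neurons L') g"
    by blast
  then show ?case
    using neuron_span_mult[OF neuron_span_mono[of L f "max L L'"] neuron_span_mono[of L' g "max L L'"]]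
    by auto
qed

section \<open>From spans of neurons to weight matrices\<close>

definition combination :: "('x \<Rightarrow> real) list \<Rightarrow> ('x \<Rightarrow> real) \<Rightarrow> bool" where
  "combination gs f \<longleftrightarrow> (\<exists>as. length as = length gs \<and> set as \<subseteq> {-1..1} \<and>
     (\<forall>x. f x = (\<Sum>j = 0..<length gs. as ! j * (gs ! j) x)))"

text \<open>Padding with zero weights. A combination is a row of a weight matrix, and rows over
  different lists of neurons are thereby brought to a common list.\<close>

lemma combination_append:
  assumes "combination gs f"
  shows "combination (gs @ hs) f" and "combination (hs @ gs) f"
proof -
  obtain as where as: "length as = length gs" "set as \<subseteq> {-1..1}"
    "\<And>x. f x = (\<Sum>j = 0..<length gs. as ! j * (gs ! j) x)"
    using assms unfolding combination_def by blast
  let ?z = "replicate (length hs) (0::real)"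
  have "(\<Sum>j = 0..<length (gs @ hs). (as @ ?z) ! j * ((gs @ hs) ! j) x) = f x" for x
    using as(1) unfolding as(3)
    by (intro sum.mono_neutral_cong_right) (auto simp: nth_append)
  then show "combination (gs @ hs) f"
    unfolding combination_def using as by (intro exI[of _ "as @ ?z"]) auto
  have "(\<Sum>j = 0..<length (hs @ gs). (?z @ as) ! j * ((hs @ gs) ! j) x) = f x" for x
  proof -
    have "(\<Sum>j = 0..<length hs + length gs. (?z @ as) ! j * ((hs @ gs) ! j) x) =
      (\<Sum>j = 0..<length hs. (?z @ as) ! j * ((hs @ gs) ! j) x) +
      (\<Sum>j = length hs..<length hs + length gs. (?z @ as) ! j * ((hs @ gs) ! j) x)"
      by (rule sum.atLeastLessThan_concat[symmetric]) auto
    also have "(\<Sum>j = length hs..<length hs + length gs. (?z @ as) ! j * ((hs @ gs) ! j) x) = f x"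
      unfolding as(3) using sum.shift_bounds_nat_ivl[of "\<lambda>j. (?z @ as) ! j * ((hs @ gs) ! j) x" 0 "length hs" "length gs"]
      by (simp add: nth_append add.commute)
    also have "(\<Sum>j = 0..<length hs. (?z @ as) ! j * ((hs @ gs) ! j) x) = 0"
      by (rule sum.neutral) (auto simp: nth_append)
    finally show ?thesis
      by simp
  qed
  then show "combination (hs @ gs) f"
    unfolding combination_def using as by (intro exI[of _ "?z @ as"]) auto
qed

lemma neuron_span_imp_combination:
  assumes "neuron_span T f"
  shows "\<exists>gs. set gs \<subseteq> T \<and> combination gs f"
  using assms
proof (induction rule: neuron_span.induct)
  case zero
  show ?case
    by (intro exI[of _ "[]"]) (simp add: combination_def)
next
  case (add \<phi> c f)
  then obtain gs as where gs: "set gs \<subseteq> T" "length as = length gs" "set as \<subseteq> {-1..1}"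
    "\<And>x. f x = (\<Sum>j = 0..<length gs. as ! j * (gs ! j) x)"
    unfolding combination_def by blast
  have "combination (\<phi> # gs) (\<lambda>x. c * \<phi> x + f x)"
    unfolding combination_def using gs(2-4) add.hyps(2)
    by (intro exI[of _ "c # as"]) (auto simp: sum.atLeast0_lessThan_Suc_shift simp del: sum.op_ivl_Suc)
  then show ?case
    using gs(1) add.hyps(1) by (intro exI[of _ "\<phi> # gs"]) auto
qed

text \<open>All neurons of a layer read the same preceding layer, which is obtained by concatenating
  the lists for the single functions. The neuron \<open>\<phi>\<close> ensures that the list is
  nonempty, as \<open>hidden_dims\<close> demands positive widths.\<close>

lemma common_combination:
  assumes "\<And>f. f \<in> set fs \<Longrightarrow> neuron_span T f" and "\<phi> \<in> T"
  shows "\<exists>gs. gs \<noteq> [] \<and> set gs \<subseteq> T \<and> (\<forall>f\<in>set fs. combination gs f)"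
  using assms(1)
proof (induction fs)
  case Nil
  show ?case
    using assms(2) by (intro exI[of _ "[\<phi>]"]) auto
next
  case (Cons f fs)
  then obtain gs where gs: "gs \<noteq> []" "set gs \<subseteq> T" "\<forall>f\<in>set fs. combination gs f"
    by auto
  obtain hs where "set hs \<subseteq> T" "combination hs f"
    using neuron_span_imp_combination[OF Cons.prems[of f]] by auto
  with gs show ?case
    by (intro exI[of _ "gs @ hs"]) (auto intro: combination_append)
qed

lemma affine_layer_vec:
  "i < k \<Longrightarrow> vec_index (affine_layer (Matrix.mat k n (\<lambda>(i, j). A i j), Matrix.vec k b) (Matrix.vec n z)) i =
    (\<Sum>j = 0..<n. A i j * z j) + b i"
  by (simp add: affine_layer_def scalar_prod_def)

lemma dim_affine_layer [simp]: "dim_vec (affine_layer l z) = dim_vec (snd l)"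
  by (simp add: affine_layer_def)

lemma sum_from_nat_into:
  "(\<Sum>k = 0..<CARD('n::finite). F (from_nat_into (UNIV :: 'n set) k)) = (\<Sum>j\<in>UNIV. F j)"
  using bij_betw_from_nat_into_finite[of "UNIV :: 'n set"]
  by (intro sum.reindex_bij_betw) (simp add: atLeast0LessThan)

text \<open>Induction on the depth: a common list of neurons for all functions in \<open>fs\<close>
  forms the preceding layer, and the coefficients of the combinations become the rows of the new
  weight matrix, with bias 0.\<close>

lemma neurons_network:
  fixes fs :: "(real^'n::finite \<Rightarrow> real) list"
  assumes "fs \<noteq> []" and "set fs \<subseteq> neurons L"
  shows "\<exists>ls. ls \<noteq> [] \<and> hidden_dims CARD('n) (length fs) ls \<and> (\<forall>l\<in>set ls. bounded_layer l) \<and>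
    (\<forall>x::real^'n. hidden_output ls (coords x) = Matrix.vec (length fs) (\<lambda>i. (fs ! i) x))"
  using assms
proof (induction L arbitrary: fs)
  case 0
  \<comment> \<open>The weights and the bias of a neuron are paired so that one application of
    \<open>bchoice\<close> selects both.\<close>
  define Q where "Q i ab \<longleftrightarrow> (\<forall>j. fst ab j \<in> {-1..1}) \<and> snd ab \<in> {-1..1} \<and>
      fs ! i = (\<lambda>x. RePU ((\<Sum>j\<in>UNIV. fst ab j * vec_nth x j) + snd ab))" for i ab
  have "\<forall>i\<in>{..<length fs}. \<exists>ab. Q i ab"
  proof
    fix i assume "i \<in> {..<length fs}"
    then have "fs ! i \<in> neurons 0"
      using 0 by auto
    then show "\<exists>ab. Q i ab"
      by (auto simp: neurons.simps Q_def)
  qed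
  then obtain ab where "\<forall>i\<in>{..<length fs}. Q i (ab i)"
    by (rule bchoice[THEN exE])
  moreover define a where "a i = fst (ab i)" for i
  moreover define b where "b i = snd (ab i)" for i
  ultimately have ab: "\<And>i j. i < length fs \<Longrightarrow> a i j \<in> {-1..1}"
    "\<And>i. i < length fs \<Longrightarrow> b i \<in> {-1..1}"
    "\<And>i. i < length fs \<Longrightarrow> fs ! i = (\<lambda>x. RePU ((\<Sum>j\<in>UNIV. a i j * vec_nth x j) + b i))"
    by (simp_all add: Q_def)
  \<comment> \<open>The columns follow the enumeration of the index type used in
    \<open>coords\<close>.\<close>
  define l where "l = (Matrix.mat (length fs) CARD('n) (\<lambda>(i, j). a i (from_nat_into UNIV j)),
      Matrix.vec (length fs) b)"
  have "bounded_layer l"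
    using ab(1,2) by (simp add: bounded_layer_def l_def)
  moreover have "layer_dims CARD('n) (length fs) l"
    by (simp add: layer_dims_def l_def)
  moreover have "map_vec RePU (affine_layer l (coords x)) = Matrix.vec (length fs) (\<lambda>i. (fs ! i) x)"
    for x :: "real^'n"
  proof (rule eq_vecI)
    fix i assume "i < dim_vec (Matrix.vec (length fs) (\<lambda>i. (fs ! i) x))"
    then have i: "i < length fs" by simp
    have "vec_index (affine_layer l (coords x)) i = (\<Sum>j\<in>UNIV. a i j * vec_nth x j) + b i"
      using i sum_from_nat_into[of "\<lambda>j. a i j * vec_nth x j"]
      by (simp add: l_def coords_def affine_layer_vec)
    then show "vec_index (map_vec RePU (affine_layer l (coords x))) i =
        vec_index (Matrix.vec (length fs) (\<lambda>i. (fs ! i) x)) i"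
      using i ab(3)[OF i] by (simp add: l_def)
  qed (simp add: l_def)
  ultimately show ?case
    using 0(1) by (intro exI[of _ "[l]"]) auto
next
  case (Suc L)
  have "\<forall>i<length fs. \<exists>h. neuron_span (neurons L) h \<and> fs ! i = (\<lambda>x. RePU (h x))"
  proof (intro allI impI)
    fix i assume "i < length fs"
    then have "fs ! i \<in> neurons (Suc L)"
      using Suc.prems by auto
    then show "\<exists>h. neuron_span (neurons L) h \<and> fs ! i = (\<lambda>x. RePU (h x))"
      by (auto simp: neurons.simps)
  qed
  then obtain h where h: "\<And>i. i < length fs \<Longrightarrow> neuron_span (neurons L) (h i)"
    "\<And>i. i < length fs \<Longrightarrow> fs ! i = (\<lambda>x. RePU (h i x))"
    by metis
  have "\<exists>gs. gs \<noteq> [] \<and> set gs \<subseteq> neurons L \<and> (\<forall>f\<in>set (map h [0..<length fs]). combination gs f)"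
    by (rule common_combination[OF _ one_in_neurons]) (use h(1) in auto)
  then obtain gs where gs: "gs \<noteq> []" "set gs \<subseteq> neurons L"
    "\<And>i. i < length fs \<Longrightarrow> combination gs (h i)"
    by auto
  have "\<forall>i\<in>{..<length fs}. \<exists>as. length as = length gs \<and> set as \<subseteq> {-1..1} \<and>
     (\<forall>x. h i x = (\<Sum>j = 0..<length gs. as ! j * (gs ! j) x))"
    using gs(3) unfolding combination_def by blast
  then obtain a where "\<forall>i\<in>{..<length fs}. length (a i) = length gs \<and> set (a i) \<subseteq> {-1..1} \<and>
     (\<forall>x. h i x = (\<Sum>j = 0..<length gs. a i ! j * (gs ! j) x))"
    by (rule bchoice[THEN exE])
  then have a: "\<And>i. i < length fs \<Longrightarrow> length (a i) = length gs"
    "\<And>i. i < length fs \<Longrightarrow> set (a i) \<subseteq> {-1..1}"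
    "\<And>i x. i < length fs \<Longrightarrow> h i x = (\<Sum>j = 0..<length gs. a i ! j * (gs ! j) x)"
    by blast+
  obtain ls where ls: "ls \<noteq> []" "hidden_dims CARD('n) (length gs) ls" "\<forall>l\<in>set ls. bounded_layer l"
    "\<And>x::real^'n. hidden_output ls (coords x) = Matrix.vec (length gs) (\<lambda>i. (gs ! i) x)"
    using Suc.IH[OF gs(1,2)] by blast
  define l where "l = (Matrix.mat (length fs) (length gs) (\<lambda>(i, j). a i ! j), Matrix.vec (length fs) (\<lambda>i. 0::real))"
  have a_bound: "a i ! j \<in> {-1..1}" if "i < length fs" "j < length gs" for i j
    by (rule subsetD[OF a(2)[OF that(1)] nth_mem]) (simp add: a(1) that)
  then have "bounded_layer l"
    by (simp add: bounded_layer_def l_def)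
  moreover have "hidden_dims CARD('n) (length fs) (ls @ [l])"
    using Suc.prems(1) by (intro hidden_dims_append[OF ls(2)]) (auto simp: layer_dims_def l_def)
  moreover have "hidden_output (ls @ [l]) (coords x) = Matrix.vec (length fs) (\<lambda>i. (fs ! i) x)"
    for x :: "real^'n"
  proof (rule eq_vecI)
    fix i assume "i < dim_vec (Matrix.vec (length fs) (\<lambda>i. (fs ! i) x))"
    then have i: "i < length fs" by simp
    then show "vec_index (hidden_output (ls @ [l]) (coords x)) i =
        vec_index (Matrix.vec (length fs) (\<lambda>i. (fs ! i) x)) i"
      by (simp add: l_def hidden_output_append ls(4) affine_layer_vec h(2) a(3))
  qed (simp add: l_def hidden_output_append)
  ultimately show ?case
    using ls(3) by (intro exI[of _ "ls @ [l]"]) auto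
qed

theorem polynomial_network:
  fixes p :: "real^'n::finite \<Rightarrow> real"
  assumes "real_polynomial_function p"
  obtains N where "is_network CARD('n) N" "set (params N) \<subseteq> {-1..1}" "\<And>x::real^'n. realize N x = p x"
proof -
  obtain L where "neuron_span (neurons L) p"
    using polynomial_in_neuron_span[OF assms] by blast
  then obtain gs where gs: "gs \<noteq> []" "set gs \<subseteq> neurons L" "combination gs p"
    using common_combination[of "[p]", OF _ one_in_neurons] by auto
  obtain as where as: "length as = length gs" "set as \<subseteq> {-1..1}"
    "\<And>x. p x = (\<Sum>j = 0..<length gs. as ! j * (gs ! j) x)"
    using gs(3) unfolding combination_def by blast
  obtain ls where ls: "ls \<noteq> []" "hidden_dims CARD('n) (length gs) ls" "\<forall>l\<in>set ls. bounded_layer l"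
    "\<And>x::real^'n. hidden_output ls (coords x) = Matrix.vec (length gs) (\<lambda>i. (gs ! i) x)"
    using neurons_network[OF gs(1,2)] by blast
  define l where "l = (Matrix.mat 1 (length gs) (\<lambda>(i, j). as ! j), Matrix.vec 1 (\<lambda>i. 0::real))"
  have "as ! j \<in> {-1..1}" if "j < length gs" for j
    by (rule subsetD[OF as(2) nth_mem]) (simp add: as(1) that)
  then have "bounded_layer l"
    by (simp add: bounded_layer_def l_def)
  then have "set (params (ls, l)) \<subseteq> {-1..1}"
    using ls(3) set_layer_params[of l] by (simp add: params_def UN_subset_iff set_layer_params)
  moreover have "is_network CARD('n) (ls, l)"
    using ls(1,2) by (auto simp: is_network_def layer_dims_def l_def)
  moreover have "realize (ls, l) x = p x" for x :: "real^'n"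
    using affine_layer_vec[of 0 1 "length gs" "\<lambda>i j. as ! j" "\<lambda>i. 0" "\<lambda>i. (gs ! i) x"]
    by (simp add: realize_def ls(4) l_def as(3))
  ultimately show thesis
    using that by blast
qed

section \<open>Classical derivatives are weak derivatives\<close>

lemma integrable_compact_support:
  fixes f :: "'a::euclidean_space \<Rightarrow> real"
  assumes "compact K" "continuous_on K f" and "\<And>x. x \<notin> K \<Longrightarrow> f x = 0"
  shows "integrable lborel f"
proof -
  have eq: "indicator K x *\<^sub>R f x = f x" for x
    using assms(3) by (cases "x \<in> K") auto
  show ?thesis
    using borel_integrable_compact[OF assms(1,2)] by (simp only: eq)
qed

text \<open>The difference quotients \<open>s n\<close> along \<open>e\<close> have integral 0 by
  translation invariance and converge pointwise to \<open>F'\<close>; dominated convergence passes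
  to the limit.\<close>

lemma integral_directional_derivative_eq_0:
  fixes F F' :: "'a::euclidean_space \<Rightarrow> real"
  assumes K: "compact K" and F: "continuous_on K F" "\<And>x. x \<notin> K \<Longrightarrow> F x = 0"
    and F': "continuous_on K F'" "\<And>x. x \<notin> K \<Longrightarrow> F' x = 0"
    and deriv: "\<And>x. \<exists>D. (F has_derivative D) (at x) \<and> D e = F' x"
  shows "(LINT x|lborel. F' x) = 0"
proof -
  have int: "integrable lborel F" "integrable lborel F'"
    using integrable_compact_support[OF K] F F' by auto
  obtain B where B: "\<And>x. norm (F' x) \<le> B"
  proof -
    obtain B where "0 < B" "\<And>x. x \<in> K \<Longrightarrow> norm (F' x) \<le> B"
      using compact_imp_bounded[OF compact_continuous_image[OF F'(1) K]] unfolding bounded_pos by blast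
    then show thesis
      using F'(2) by (intro that[of B]) (metis less_imp_le norm_zero)
  qed
  obtain R where R: "\<And>x. x \<in> K \<Longrightarrow> norm x \<le> R"
    using compact_imp_bounded[OF K] unfolding bounded_pos by blast
  have line: "((\<lambda>r. F (x + r *\<^sub>R e)) has_real_derivative F' (x + r *\<^sub>R e)) (at r)" for x r
  proof -
    obtain D where D: "(F has_derivative D) (at (x + r *\<^sub>R e))" "D e = F' (x + r *\<^sub>R e)"
      using deriv by blast
    have "((\<lambda>r. x + r *\<^sub>R e) has_derivative (\<lambda>h. h *\<^sub>R e)) (at r)"
      by (auto intro!: derivative_eq_intros)
    from has_derivative_compose[OF this D(1)]
    have "((\<lambda>r. F (x + r *\<^sub>R e)) has_derivative (\<lambda>h. D (h *\<^sub>R e))) (at r)" .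
    moreover have "D (h *\<^sub>R e) = F' (x + r *\<^sub>R e) * h" for h
      using linear_scale[OF has_derivative_linear[OF D(1)]] D(2) by simp
    ultimately show ?thesis
      by (simp add: has_field_derivative_def)
  qed
  define s where "s n x = (F (x + inverse (real (Suc n)) *\<^sub>R e) - F x) / inverse (real (Suc n))" for n x
  have "F \<in> borel_measurable lborel"
    using int(1) by auto
  then have F_meas [measurable]: "F \<in> borel_measurable borel"
    by simp
  have translate: "integrable lborel (\<lambda>x. F (x + c))" "(LINT x|lborel. F (x + c)) = (LINT x|lborel. F x)" for c
  proof -
    have meas: "(+) c \<in> lborel \<rightarrow>\<^sub>M borel"
      by measurable
    have "integrable (distr lborel borel ((+) c)) F"
      using int(1) by (simp add: lborel_distr_plus)
    then show "integrable lborel (\<lambda>x. F (x + c))"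
      by (subst (asm) integrable_distr_eq[OF meas F_meas]) (simp add: add.commute)
    have "(LINT x|lborel. F x) = (LINT x|distr lborel borel ((+) c). F x)"
      by (simp add: lborel_distr_plus)
    also have "\<dots> = (LINT x|lborel. F (c + x))"
      by (rule integral_distr[OF meas F_meas])
    finally show "(LINT x|lborel. F (x + c)) = (LINT x|lborel. F x)"
      by (simp add: add.commute)
  qed
  have s0: "(LINT x|lborel. s n x) = 0" for n
    unfolding s_def using int(1) translate by simp
  \<comment> \<open>The increments \<open>inverse (Suc n)\<close> are at most 1, so all quotients
    vanish outside the ball of radius \<open>R + norm e\<close>; inside it the mean value theorem
    bounds them by \<open>B\<close>.\<close>
  let ?W = "\<lambda>x. indicator (cball 0 (R + norm e)) x *\<^sub>R B"
  have "(\<lambda>n. LINT x|lborel. s n x) \<longlonglongrightarrow> (LINT x|lborel. F' x)"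
  proof (rule integral_dominated_convergence)
    show "F' \<in> borel_measurable lborel"
      using int(2) by auto
    show "s n \<in> borel_measurable lborel" for n
      unfolding s_def[abs_def] by measurable
    show "integrable lborel ?W"
      by (rule borel_integrable_compact) auto
    have lim: "(\<lambda>n. s n x) \<longlonglongrightarrow> F' x" for x
    proof -
      have "((\<lambda>h. (F (x + h *\<^sub>R e) - F x) / h) \<longlongrightarrow> F' x) (at 0)"
        using line[of x 0] by (simp add: DERIV_def)
      moreover have "filterlim (\<lambda>n. inverse (real (Suc n))) (at 0) sequentially"
        by (intro filterlim_atI LIMSEQ_inverse_real_of_nat) auto
      ultimately show ?thesis
        unfolding s_def by (rule filterlim_compose)
    qed
    then show "AE x in lborel. (\<lambda>n. s n x) \<longlonglongrightarrow> F' x"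
      by simp
    have "norm (s n x) \<le> ?W x" for n x
    proof (cases "x \<in> cball 0 (R + norm e)")
      case True
      let ?t = "inverse (real (Suc n))"
      have "\<exists>z>0. z < ?t \<and> F (x + ?t *\<^sub>R e) - F (x + 0 *\<^sub>R e) = (?t - 0) * F' (x + z *\<^sub>R e)"
        using line by (intro MVT2) auto
      then obtain z where "F (x + ?t *\<^sub>R e) - F x = ?t * F' (x + z *\<^sub>R e)"
        by auto
      then have "s n x = F' (x + z *\<^sub>R e)"
        unfolding s_def by (metis nonzero_mult_div_cancel_left inverse_nonzero_iff_nonzero of_nat_eq_0_iff nat.distinct(2))
      then show ?thesis
        using True B by simp
    next
      case False
      have "x \<notin> K"
        using False R[of x] norm_ge_zero[of e] by auto
      moreover have "x + inverse (real (Suc n)) *\<^sub>R e \<notin> K"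
      proof
        assume "x + inverse (real (Suc n)) *\<^sub>R e \<in> K"
        then have 1: "norm (x + inverse (real (Suc n)) *\<^sub>R e) \<le> R"
          by (rule R)
        have "norm x \<le> norm (x + inverse (real (Suc n)) *\<^sub>R e) + norm (inverse (real (Suc n)) *\<^sub>R e)"
          using norm_triangle_ineq4[of "x + inverse (real (Suc n)) *\<^sub>R e" "inverse (real (Suc n)) *\<^sub>R e"]
          by simp
        moreover have "norm (inverse (real (Suc n)) *\<^sub>R e) \<le> 1 * norm e"
          unfolding norm_scaleR by (intro mult_right_mono) (auto simp: field_simps)
        ultimately show False
          using 1 False by simp
      qed
      ultimately show ?thesis
        using False F(2) by (simp add: s_def)
    qed
    then show "AE x in lborel. norm (s n x) \<le> ?W x" for n
      by simp
  qed
  then show ?thesis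
    unfolding s0 by (simp add: LIMSEQ_const_iff)
qed

text \<open>The function vanishes outside \<open>U\<close>, and completing the measure does not
  change the integral of a Borel function.\<close>

lemma lebesgue_on_integral_compact_support:
  fixes f :: "'a::euclidean_space \<Rightarrow> real"
  assumes K: "compact K" "K \<subseteq> U" and U: "open U"
    and f: "continuous_on K f" "\<And>x. x \<notin> K \<Longrightarrow> f x = 0"
  shows "integrable lborel f" "(LINT x|lebesgue_on U. f x) = (LINT x|lborel. f x)"
proof -
  show int: "integrable lborel f"
    using integrable_compact_support[OF K(1) f] .
  have eq: "indicator U x *\<^sub>R f x = f x" for x
    using f(2) K(2) by (cases "x \<in> K") (auto simp: indicator_def)
  have "U \<inter> space lebesgue \<in> sets lebesgue"
    using U by simp
  from integral_restrict_space[OF this, of f]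
  have "(LINT x|lebesgue_on U. f x) = (LINT x|lebesgue. f x)"
    unfolding eq .
  also have "\<dots> = (LINT x|lborel. f x)"
    using int by (intro integral_completion) auto
  finally show "(LINT x|lebesgue_on U. f x) = (LINT x|lborel. f x)" .
qed

lemma locally_integrable_continuous_on:
  assumes "continuous_on U f"
  shows "locally_integrable U f"
  unfolding locally_integrable_def set_integrable_def
proof (intro allI impI, elim conjE)
  fix K assume K: "compact K" "K \<subseteq> U"
  have "integrable lborel (\<lambda>x. indicator K x *\<^sub>R f x)"
    using K assms by (intro borel_integrable_compact) (auto intro: continuous_on_subset)
  then show "integrable lebesgue (\<lambda>x. indicator K x *\<^sub>R f x)"
    by (subst integrable_completion) auto
qed

text \<open>Integration by parts: the product of \<open>w\<close> with a test function has compact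
  support in \<open>U\<close>, so its derivative along the axis has integral 0, and the product rule
  splits this integral.\<close>

lemma has_weak_partial_classical:
  fixes w :: "real^'n::finite \<Rightarrow> real"
  assumes U: "open U" and w: "\<And>x. x \<in> U \<Longrightarrow> (w has_derivative inner (w' x)) (at x)"
    and w': "continuous_on U w'"
  shows "has_weak_partial U i w (\<lambda>x. vec_nth (w' x) i)"
proof -
  let ?v = "\<lambda>x. vec_nth (w' x) i"
  have cont: "continuous_on U w" "continuous_on U ?v"
    using w w' by (auto intro!: continuous_at_imp_continuous_on has_derivative_continuous continuous_intros)
  have "(LINT x|lebesgue_on U. w x * partial_derivative i \<psi> x) = - (LINT x|lebesgue_on U. ?v x * \<psi> x)"
    if \<psi>: "\<psi> \<in> test_functions U" for \<psi>
  proof -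
    define K where "K = closure {x. \<psi> x \<noteq> 0}"
    have K: "compact K" "K \<subseteq> U"
      using \<psi> by (auto simp: test_functions_def K_def)
    have "Ck (Suc 0) \<psi>"
      using \<psi> unfolding test_functions_def by blast
    then have diff: "\<psi> differentiable (at x)" and cont_\<psi>': "continuous_on UNIV (partial_derivative i \<psi>)" for x
      by auto
    have deriv_\<psi>: "(\<psi> has_derivative frechet_derivative \<psi> (at x)) (at x)" for x
      using diff frechet_derivative_works by blast
    have cont_\<psi>: "continuous_on UNIV \<psi>"
      using deriv_\<psi> by (auto intro!: continuous_at_imp_continuous_on has_derivative_continuous)
    have \<psi>0: "\<psi> x = 0" if "x \<notin> K" for x
      using that closure_subset[of "{x. \<psi> x \<noteq> 0}"] by (auto simp: K_def)
    \<comment> \<open>The complement of \<open>K\<close> is open. This settles the points outside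
      \<open>U\<close>, where nothing is known about \<open>w\<close>.\<close>
    have zero_deriv: "(f has_derivative (\<lambda>h. 0)) (at x)" if "x \<notin> K" "\<And>x. x \<notin> K \<Longrightarrow> f x = 0"
      for f :: "real^'n \<Rightarrow> real" and x
    proof (rule has_derivative_transform_within_open[of "\<lambda>x. 0"])
      show "open (- K)" "x \<in> - K"
        using that(1) by (auto simp: K_def)
    qed (use that(2) in auto)
    have \<psi>'0: "partial_derivative i \<psi> x = 0" if "x \<notin> K" for x
      using fun_cong[OF frechet_derivative_at[OF zero_deriv[where f = \<psi>, OF that \<psi>0]], of "axis i 1"]
      by (simp add: partial_derivative_def)
    have contK: "continuous_on K w" "continuous_on K ?v" "continuous_on K \<psi>"
        "continuous_on K (partial_derivative i \<psi>)"
      using cont cont_\<psi> cont_\<psi>' K(2) by (auto intro: continuous_on_subset)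
    have "(LINT x|lborel. w x * partial_derivative i \<psi> x + ?v x * \<psi> x) = 0"
    proof (rule integral_directional_derivative_eq_0[OF K(1), of "\<lambda>x. w x * \<psi> x" _ "axis i 1"])
      fix x
      show "\<exists>D. ((\<lambda>x. w x * \<psi> x) has_derivative D) (at x) \<and>
          D (axis i 1) = w x * partial_derivative i \<psi> x + ?v x * \<psi> x"
      proof (cases "x \<in> K")
        case True
        with K(2) have "x \<in> U"
          by blast
        show ?thesis
          by (rule exI, rule conjI, rule has_derivative_mult[OF w[OF \<open>x \<in> U\<close>] deriv_\<psi>])
            (simp add: partial_derivative_def inner_axis)
      next
        case False
        then show ?thesis
          using zero_deriv[OF False, of "\<lambda>x. w x * \<psi> x"] \<psi>0 \<psi>'0 by (intro exI[of _ "\<lambda>h. 0"]) auto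
      qed
    qed (use contK \<psi>0 \<psi>'0 in \<open>auto intro!: continuous_intros\<close>)
    moreover have "continuous_on K (\<lambda>x. w x * partial_derivative i \<psi> x)" "continuous_on K (\<lambda>x. ?v x * \<psi> x)"
      using contK by (auto intro!: continuous_intros)
    note lebesgue_on_integral_compact_support[OF K U this(1)] lebesgue_on_integral_compact_support[OF K U this(2)]
    ultimately show ?thesis
      using \<psi>0 \<psi>'0 by simp
  qed
  then show ?thesis
    using cont[THEN locally_integrable_continuous_on] by (simp add: has_weak_partial_def)
qed

section \<open>Bounding the Sobolev norm by pointwise estimates\<close>

lemma sup_norm_le:
  assumes "closed S" "continuous_on S f" "\<And>x. x \<in> S \<Longrightarrow> \<bar>f x\<bar> \<le> e"
  shows "sup_norm S f \<le> ennreal e"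
  unfolding sup_norm_def
proof (rule esssup_I)
  \<comment> \<open>Measurability matters: \<open>esssup\<close> takes the value \<open>top\<close>
    on functions that are not measurable.\<close>
  have "(\<lambda>x. \<bar>f x\<bar>) \<in> borel_measurable (lebesgue_on S)"
    using assms(1,2) by (intro continuous_imp_measurable_on_sets_lebesgue continuous_intros) auto
  then show "(\<lambda>x. ennreal \<bar>f x\<bar>) \<in> borel_measurable (lebesgue_on S)"
    by measurable
  show "AE x in lebesgue_on S. ennreal \<bar>f x\<bar> \<le> ennreal e"
    using assms(3) by (intro AE_I2) (auto simp: space_restrict_space intro!: ennreal_leI)
qed

text \<open>The components of the classical gradient are candidates in the infimum over weak
  partials and are bounded by its norm.\<close>

lemma W1inf_norm_le:
  fixes w :: "real^'n::finite \<Rightarrow> real"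
  assumes S: "closed S" and w: "continuous_on S w" "\<And>x. x \<in> S \<Longrightarrow> \<bar>w x\<bar> \<le> e"
    and w': "continuous_on S w'" "\<And>x. x \<in> S \<Longrightarrow> norm (w' x) \<le> e"
    and deriv: "\<And>x. x \<in> interior S \<Longrightarrow> (w has_derivative inner (w' x)) (at x)"
  shows "W1inf_norm S w \<le> ennreal e"
proof -
  have "(INF v \<in> {v. has_weak_partial (interior S) i w v}. sup_norm S v) \<le> ennreal e" for i
  proof (rule INF_lower2)
    show "(\<lambda>x. vec_nth (w' x) i) \<in> {v. has_weak_partial (interior S) i w v}"
      using has_weak_partial_classical[OF open_interior deriv continuous_on_subset[OF w'(1) interior_subset]]
      by blast
    show "sup_norm S (\<lambda>x. vec_nth (w' x) i) \<le> ennreal e"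
      using w'(1) order_trans[OF component_le_norm_cart w'(2)]
      by (intro sup_norm_le[OF S] continuous_on_component)
  qed
  then show ?thesis
    using sup_norm_le[OF S w] by (simp add: W1inf_norm_def)
qed

section \<open>Approximation of the target class\<close>

text \<open>Subtracting \<open>\<tau>\<close> makes the smoothed norm vanish at the origin, so that
  the approximant is small there whenever \<open>g\<close> vanishes at \<open>0\<close>.\<close>

lemma target_smoothing:
  fixes g :: "real^'n::finite \<Rightarrow> real"
  assumes g': "continuous_on cube g'"
    and g: "\<And>x. x \<in> cube \<Longrightarrow> (g has_derivative inner (g' x)) (at x within cube)"
    and \<tau>: "0 < \<tau>"
  shows "C1_approximable (\<lambda>x. g x + \<beta> * (sqrt (\<tau>\<^sup>2 + inner x x) - \<tau>))
    (\<lambda>x. g' x + (\<beta> / sqrt (\<tau>\<^sup>2 + inner x x)) *\<^sub>R x)"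
proof (rule C1_weierstrass_cube)
  have pos: "0 < \<tau>\<^sup>2 + inner x x" for x :: "real^'n"
    using \<tau> by (simp add: add_pos_nonneg)
  then show "continuous_on cube (\<lambda>x. g' x + (\<beta> / sqrt (\<tau>\<^sup>2 + inner x x)) *\<^sub>R x)"
    using g' by (intro continuous_intros) (simp_all add: less_imp_neq[THEN not_sym])
  fix x :: "real^'n" assume x: "x \<in> cube"
  have "((\<lambda>x. sqrt (\<tau>\<^sup>2 + inner x x)) has_derivative
      (\<lambda>h. (2 * inner x h) * (inverse (sqrt (\<tau>\<^sup>2 + inner x x)) / 2))) (at x within cube)"
    by (rule has_derivative_eq_rhs[OF DERIV_compose_FDERIV[where g = "\<lambda>x. \<tau>\<^sup>2 + inner x x", OF DERIV_real_sqrt[OF pos]]])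
      (auto intro!: derivative_eq_intros simp: inner_commute)
  from has_derivative_add[OF g[OF x] has_derivative_mult_right[OF has_derivative_diff[OF this has_derivative_const]], of \<beta> \<tau>]
  show "((\<lambda>x. g x + \<beta> * (sqrt (\<tau>\<^sup>2 + inner x x) - \<tau>)) has_derivative
      inner (g' x + (\<beta> / sqrt (\<tau>\<^sup>2 + inner x x)) *\<^sub>R x)) (at x within cube)"
    by (rule has_derivative_eq_rhs) (auto simp: inner_add_left fun_eq_iff field_simps)
qed

text \<open>The vector in the third bound is the difference of the gradients of the norm and of its
  smoothing. Its length is the difference of the two functions, at most \<open>\<tau>\<close>,
  divided by the smoothed norm, which is at least \<open>\<delta>\<close>.\<close>

lemma sqrt_smoothing_bounds:
  fixes x :: "'a::real_inner"
  assumes \<tau>: "0 < \<tau>" and \<delta>: "0 < \<delta>" "\<delta> \<le> norm x"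
  shows "norm x \<le> sqrt (\<tau>\<^sup>2 + inner x x)" "sqrt (\<tau>\<^sup>2 + inner x x) \<le> norm x + \<tau>"
    "norm ((1 / norm x - 1 / sqrt (\<tau>\<^sup>2 + inner x x)) *\<^sub>R x) \<le> \<tau> / \<delta>"
proof -
  let ?q = "sqrt (\<tau>\<^sup>2 + inner x x)"
  show 1: "norm x \<le> ?q"
    using \<tau> by (auto intro!: real_le_rsqrt simp: power2_norm_eq_inner)
  show 2: "?q \<le> norm x + \<tau>"
    using \<tau> by (intro real_le_lsqrt) (auto simp: power2_sum power2_norm_eq_inner)
  have pos: "0 < norm x" "0 < ?q"
    using \<delta> 1 by linarith+
  have "norm ((1 / norm x - 1 / ?q) *\<^sub>R x) = (?q - norm x) / ?q"
    using pos 1 by (simp add: abs_if field_simps)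
  also have "\<dots> \<le> \<tau> / \<delta>"
    using 1 2 \<delta> \<tau> pos by (intro frac_le) auto
  finally show "norm ((1 / norm x - 1 / ?q) *\<^sub>R x) \<le> \<tau> / \<delta>" .
qed

theorem lemma2:
  fixes \<alpha> \<alpha>' \<delta> :: real
    and \<Omega>\<^sub>\<delta> :: "(real^'n::finite) set"
  assumes "0 < \<alpha>"
    and "0 < \<alpha>'" and "\<alpha>' < \<alpha>"
    and "0 < \<delta>"
    and "\<Omega>\<^sub>\<delta> = cube - ball 0 \<delta>"
  shows "\<forall>h \<in> target_class \<alpha>. \<forall>\<epsilon>>0. \<exists>m N.
    is_network CARD('n) N \<and> length (params N) = m \<and> set (params N) \<subseteq> {-1..1} \<and>
    W1inf_norm \<Omega>\<^sub>\<delta> (\<lambda>x. lyapunov_net \<alpha>' N x - h x) \<le> ennreal \<epsilon>"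
proof (intro ballI allI impI)
  fix h :: "real^'n \<Rightarrow> real" and \<epsilon> :: real
  assume "h \<in> target_class \<alpha>" and \<epsilon>: "0 < \<epsilon>"
  then obtain g g' where h: "h = (\<lambda>x. g x + \<alpha> * norm x)"
    and g0: "\<And>x. x \<in> cube \<Longrightarrow> 0 \<le> g x" "g 0 = 0"
    and g': "continuous_on cube g'"
    and g: "\<And>x. x \<in> cube \<Longrightarrow> (g has_derivative inner (g' x)) (at x within cube)"
    unfolding target_class_def C1_on_def by blast
  define \<beta> where "\<beta> = \<alpha> - \<alpha>'"
  \<comment> \<open>The first bound keeps the smoothed norm minus \<open>\<tau>\<close> above
    \<open>\<delta> / 2\<close> on \<open>\<Omega>\<^sub>\<delta>\<close>; the other two limit the
    smoothing errors of the values and of the gradient to \<open>\<epsilon> / 2\<close>.\<close>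
  define \<tau> where "\<tau> = min (\<delta> / 2) (min (\<epsilon> / (2 * \<beta>)) (\<epsilon> * \<delta> / (2 * \<beta>)))"
  \<comment> \<open>In the values \<open>\<eta>\<close> enters twice, through \<open>p x\<close> and
    \<open>p 0\<close>, so \<open>\<epsilon> / 4\<close> suffices there. The bound
    \<open>\<beta> * \<delta> / 8\<close> keeps this double error below the gap
    \<open>\<beta> * \<delta> / 2\<close>.\<close>
  define \<eta> where "\<eta> = min (\<epsilon> / 4) (\<beta> * \<delta> / 8)"
  have \<beta>: "0 < \<beta>"
    using assms by (simp add: \<beta>_def)
  have \<tau>: "0 < \<tau>" "\<tau> \<le> \<delta> / 2" "\<beta> * \<tau> \<le> \<epsilon> / 2" "\<beta> * (\<tau> / \<delta>) \<le> \<epsilon> / 2"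
  proof -
    show "0 < \<tau>" "\<tau> \<le> \<delta> / 2"
      using \<beta> \<epsilon> assms(4) by (auto simp: \<tau>_def)
    have "\<tau> \<le> \<epsilon> / (2 * \<beta>)" "\<tau> \<le> \<epsilon> * \<delta> / (2 * \<beta>)"
      by (auto simp: \<tau>_def)
    then show "\<beta> * \<tau> \<le> \<epsilon> / 2" "\<beta> * (\<tau> / \<delta>) \<le> \<epsilon> / 2"
      using \<beta> assms(4) by (auto simp: field_simps)
  qed
  have \<eta>: "0 < \<eta>" "\<eta> \<le> \<epsilon> / 4" "\<eta> \<le> \<beta> * \<delta> / 8"
    using \<beta> \<epsilon> assms(4) by (auto simp: \<eta>_def)
  let ?q = "\<lambda>x::real^'n. sqrt (\<tau>\<^sup>2 + inner x x)"
  obtain p p' where p: "real_polynomial_function p" "continuous_on UNIV p'"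
    "\<And>x. (p has_derivative inner (p' x)) (at x)"
    "\<And>x. x \<in> cube \<Longrightarrow> \<bar>p x - (g x + \<beta> * (?q x - \<tau>))\<bar> \<le> \<eta>"
    "\<And>x. x \<in> cube \<Longrightarrow> norm (p' x - (g' x + (\<beta> / ?q x) *\<^sub>R x)) \<le> \<eta>"
    using C1_approximableE[OF target_smoothing[OF g' g \<tau>(1), of \<beta>] \<eta>(1)] by blast
  obtain N where N: "is_network CARD('n) N" "set (params N) \<subseteq> {-1..1}" "\<And>x::real^'n. realize N x = p x"
    using polynomial_network[OF p(1)] by blast
  define S where "S = \<Omega>\<^sub>\<delta>"
  have S: "S \<subseteq> cube" "closed S" "\<And>x. x \<in> S \<Longrightarrow> \<delta> \<le> norm x"
    using assms(5) compact_imp_closed[OF compact_cube] by (auto simp: S_def closed_Diff)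
  have p0: "\<bar>p 0\<bar> \<le> \<eta>"
    using p(4)[of 0] g0(2) \<tau>(1) by (simp add: cube_iff)
  \<comment> \<open>The error once the absolute value is dropped; the two multiples of the norm
    combine to \<open>- \<beta> * norm x\<close>.\<close>
  define w where "w x = p x - p 0 - g x - \<beta> * norm x" for x
  define w' where "w' x = p' x - g' x - (\<beta> / norm x) *\<^sub>R x" for x
  have w_eq: "lyapunov_net \<alpha>' N x - h x = w x" if x: "x \<in> S" for x
  proof -
    have "x \<in> cube"
      using x S(1) by blast
    note q = sqrt_smoothing_bounds(1,2)[OF \<tau>(1) assms(4) S(3)[OF x]]
    \<comment> \<open>This gap outweighs the errors of \<open>p x\<close> and \<open>p 0\<close>, so
      \<open>p x - p 0\<close> is nonnegative on \<open>S\<close> and equals its absolute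
      value.\<close>
    have "\<beta> * (\<delta> / 2) \<le> \<beta> * (?q x - \<tau>)"
      using q S(3)[OF x] \<tau>(2) \<beta> by (intro mult_left_mono) auto
    then have "0 \<le> p x - p 0"
      using p(4)[OF \<open>x \<in> cube\<close>] p0 g0(1)[OF \<open>x \<in> cube\<close>] \<eta>(3) mult_pos_pos[OF \<beta> assms(4)]
      by linarith
    then show ?thesis
      by (simp add: lyapunov_net_def N(3) h w_def \<beta>_def algebra_simps)
  qed
  have "W1inf_norm S (\<lambda>x. lyapunov_net \<alpha>' N x - h x) \<le> ennreal \<epsilon>"
  proof (rule W1inf_norm_le[OF S(2)])
    have nz: "x \<noteq> 0" if "x \<in> S" for x
      using S(3)[OF that] assms(4) by auto
    have cont_g: "continuous_on S g"
      using g continuous_on_subset[OF _ S(1)] has_derivative_continuous continuous_on_eq_continuous_within by blast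
    have cont_p: "continuous_on S p"
      using p(3) by (auto intro!: continuous_at_imp_continuous_on has_derivative_continuous)
    have "continuous_on S w"
      unfolding w_def[abs_def] using cont_g cont_p by (intro continuous_intros)
    then show "continuous_on S (\<lambda>x. lyapunov_net \<alpha>' N x - h x)"
      by (rule continuous_on_eq) (simp add: w_eq)
    show "continuous_on S w'"
      unfolding w'_def[abs_def] using continuous_on_subset[OF p(2)] continuous_on_subset[OF g' S(1)] nz
      by (intro continuous_intros) auto
  next
    fix x assume x: "x \<in> S"
    then have xc: "x \<in> cube"
      using S(1) by blast
    note q = sqrt_smoothing_bounds[OF \<tau>(1) assms(4) S(3)[OF x]]
    have "\<beta> * norm x \<le> \<beta> * ?q x" "\<beta> * ?q x \<le> \<beta> * (norm x + \<tau>)"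
      using q(1,2) \<beta> by (auto intro: mult_left_mono)
    moreover have "\<beta> * (norm x + \<tau>) = \<beta> * norm x + \<beta> * \<tau>" "\<beta> * (?q x - \<tau>) = \<beta> * ?q x - \<beta> * \<tau>"
      by (simp_all add: algebra_simps)
    ultimately have "\<bar>w x\<bar> \<le> \<epsilon>"
      using p(4)[OF xc] p0 \<eta>(2) \<tau>(3) \<epsilon> unfolding w_def by linarith
    then show "\<bar>lyapunov_net \<alpha>' N x - h x\<bar> \<le> \<epsilon>"
      by (simp add: w_eq[OF x])
    have "w' x = (p' x - (g' x + (\<beta> / ?q x) *\<^sub>R x)) - \<beta> *\<^sub>R ((1 / norm x - 1 / ?q x) *\<^sub>R x)"
      by (simp add: w'_def algebra_simps)
    then have "norm (w' x) \<le> \<eta> + \<beta> * (\<tau> / \<delta>)"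
      using norm_triangle_ineq4[of "p' x - (g' x + (\<beta> / ?q x) *\<^sub>R x)" "\<beta> *\<^sub>R ((1 / norm x - 1 / ?q x) *\<^sub>R x)"]
        p(5)[OF xc] mult_left_mono[OF q(3), of \<beta>] \<beta> by (simp only: norm_scaleR) simp
    then show "norm (w' x) \<le> \<epsilon>"
      using \<eta>(2) \<tau>(4) \<epsilon> by linarith
  next
    fix x assume x: "x \<in> interior S"
    then have "x \<in> S" "x \<in> interior cube"
      using interior_subset interior_mono[OF S(1)] by blast+
    \<comment> \<open>At interior points of the cube the derivative within the cube is a full
      derivative.\<close>
    then have dg: "(g has_derivative inner (g' x)) (at x)"
      using g[of x] S(1) at_within_interior[of x cube] by auto
    have "x \<noteq> 0"
      using S(3)[OF \<open>x \<in> S\<close>] assms(4) by auto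
    then have dn: "((\<lambda>x. \<beta> * norm x) has_derivative (\<lambda>h. \<beta> * inner h (sgn x))) (at x)"
      by (intro has_derivative_mult_right has_derivative_norm)
    have "(\<lambda>h. inner (p' x) h - 0 - inner (g' x) h - \<beta> * inner h (sgn x)) = inner (w' x)"
    proof
      fix h :: "real^'n"
      have "inner h (sgn x) = inner x h / norm x"
        by (simp add: sgn_div_norm inner_commute[of h x] divide_inverse)
      then show "inner (p' x) h - 0 - inner (g' x) h - \<beta> * inner h (sgn x) = inner (w' x) h"
        by (simp add: w'_def inner_diff_left)
    qed
    then have "(w has_derivative inner (w' x)) (at x)"
      unfolding w_def[abs_def]
      using has_derivative_diff[OF has_derivative_diff[OF has_derivative_diff[OF p(3) has_derivative_const] dg] dn]
      by simp
    \<comment> \<open>The error agrees with \<open>w\<close> on \<open>S\<close> only, so the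
      derivative is transferred on its open interior.\<close>
    then show "((\<lambda>x. lyapunov_net \<alpha>' N x - h x) has_derivative inner (w' x)) (at x)"
    proof (rule has_derivative_transform_within_open[OF _ open_interior x])
      fix y assume "y \<in> interior S"
      then have "y \<in> S"
        using interior_subset by blast
      then show "w y = lyapunov_net \<alpha>' N y - h y"
        by (rule w_eq[symmetric])
    qed
  qed
  then show "\<exists>m N. is_network CARD('n) N \<and> length (params N) = m \<and> set (params N) \<subseteq> {-1..1} \<and>
    W1inf_norm \<Omega>\<^sub>\<delta> (\<lambda>x. lyapunov_net \<alpha>' N x - h x) \<le> ennreal \<epsilon>"
    using N(1,2) unfolding S_def by blast
qed

end
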